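(* Let $G$ be a simple graph with vertex set $[\ell]=\{1,\dots,\ell\}$. Then $$\mathrm{Hilb}(\Omega^1(\mathcal{A}_G),t)=\sum_{\varnothing\ne F\in\Delta(G)}\frac{t^{1-\#F}}{(1-t)^{\ell-\#F+1}}.$$
   Context: Let $\mathbb{K}$ be a field, $V=\mathbb{K}^\ell$ and $S=\mathbb{K}[x_1,\dots,x_\ell]$ with $\deg x_i=1$, where $x_1,\dots,x_\ell$ are the coordinate functions. For a simple graph $G$ with vertex set $[\ell]$ and edge set $E(G)$, the graphic arrangement is $\mathcal{A}_G=\{\{x_u=x_v\}\mid\{u,v\}\in E(G)\}$. $\Delta(G)$ is the clique complex of $G$: the set of all cliques of $G$, i.e. subsets $F\subset[\ell]$ such that $\{u,v\}\in E(G)$ for all distinct $u,v\in F$ (including $\varnothing$ and all singletons). For a finite set $\mathcal{A}$ of linear hyperplanes in $V$, $\alpha_H\in V^*$ denotes a defining linear form of $H\in\mathcal{A}$ and $Q(\mathcal{A})=\prod_{H\in\mathcal{A}}\alpha_H$. Let $\Omega_V^1=\bigoplus_i S\,dx_i$, $\Omega_V^2=\bigwedge^2\Omega_V^1$, and for $\alpha=\sum c_ix_i$ let $d\alpha=\sum c_i\,dx_i$. Define $$\Omega^1(\mathcal{A})=\{\omega\in \tfrac{1}{Q(\mathcal{A})}\Omega^1_V \mid Q(\mathcal{A})\,\omega\wedge d\alpha_H\in\alpha_H\Omega_V^2\ \text{for all } H\in\mathcal{A}\},$$ graded by setting $\deg(dx_i)=0$ (so $f\,dx_i$ with $f$ a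 homogeneous rational function has degree $\deg f$, possibly negative). For a graded module $M=\bigoplus_{i\in\mathbb{Z}}M_i$, $\mathrm{Hilb}(M,t)=\sum_{i\in\mathbb{Z}}(\dim_{\mathbb{K}}M_i)t^i$. *)

theory Defs
  imports
    "HOL-Library.Poly_Mapping"
    "HOL-Library.Function_Algebras"
    "HOL-Library.FuncSet"
    "HOL-Library.Ramsey"
    "HOL-Computational_Algebra.Computational_Algebra"
begin

section \<open>Polynomials and rational functions\<close>

text \<open>
  Polynomials over \<open>\<K>\<close> in variables indexed by \<^typ>\<open>nat\<close>: finitely supported maps from
  exponent vectors to coefficients. The ring \<open>S = \<K>[x\<^sub>1,\<dots>,x\<^sub>l]\<close> is the carrier
  \<open>poly_ring l\<close>, and its fraction field is taken inside that of the ambient ring.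
\<close>

type_synonym 'k mpoly = "(nat \<Rightarrow>\<^sub>0 nat) \<Rightarrow>\<^sub>0 'k"
type_synonym 'k ratfun = "'k mpoly fract"

definition poly_ring :: "nat \<Rightarrow> ('k::field) mpoly set" where
  "poly_ring l = {p. \<forall>m\<in>Poly_Mapping.keys p. Poly_Mapping.keys m \<subseteq> {1..l}}"

definition const :: "('k::field) \<Rightarrow> 'k ratfun" where
  "const c = to_fract (Poly_Mapping.single 0 c)"

definition monomial_degree :: "(nat \<Rightarrow>\<^sub>0 nat) \<Rightarrow> nat" where
  "monomial_degree m = (\<Sum>i\<in>Poly_Mapping.keys m. Poly_Mapping.lookup m i)"

definition homogeneous :: "nat \<Rightarrow> ('k::field) mpoly \<Rightarrow> bool" where
  "homogeneous n p \<longleftrightarrow> (\<forall>m\<in>Poly_Mapping.keys p. monomial_degree m = n)"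

text \<open>The zero function is homogeneous of every degree.\<close>

definition homogeneous_ratfun :: "int \<Rightarrow> ('k::field) ratfun \<Rightarrow> bool" where
  "homogeneous_ratfun d f \<longleftrightarrow>
     (\<exists>p q m n. homogeneous m p \<and> homogeneous n q \<and> q \<noteq> 0
        \<and> f = Fraction_Field.Fract p q \<and> d = int m - int n)"

section \<open>Differential forms\<close>

text \<open>
  A rational 1-form \<open>\<Sum>i. \<omega> i dx\<^sub>i\<close> is given by its coefficient function \<open>\<omega>\<close>, and a rational
  2-form \<open>\<Sum>i<j. \<theta> (i, j) dx\<^sub>i \<and> dx\<^sub>j\<close> by \<open>\<theta>\<close>. All coefficients at indices that
  do not belong to the basis are \<open>0\<close>.
\<close>

type_synonym 'k form1 = "nat \<Rightarrow> 'k ratfun"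
type_synonym 'k form2 = "nat \<times> nat \<Rightarrow> 'k ratfun"

definition Omega1 :: "nat \<Rightarrow> ('k::field) form1 set" where
  "Omega1 l = {\<omega>. (\<forall>i\<in>{1..l}. \<omega> i \<in> to_fract ` poly_ring l) \<and> (\<forall>i. i \<notin> {1..l} \<longrightarrow> \<omega> i = 0)}"

definition Omega2 :: "nat \<Rightarrow> ('k::field) form2 set" where
  "Omega2 l = {\<theta>. \<forall>i j.
     (if 1 \<le> i \<and> i < j \<and> j \<le> l then \<theta> (i, j) \<in> to_fract ` poly_ring l else \<theta> (i, j) = 0)}"

definition wedge :: "('k::field) form1 \<Rightarrow> 'k form1 \<Rightarrow> 'k form2" where
  "wedge \<omega> \<eta> = (\<lambda>(i, j). if i < j then \<omega> i * \<eta> j - \<omega> j * \<eta> i else 0)"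

definition form_mult :: "('k::field) ratfun \<Rightarrow> ('i \<Rightarrow> 'k ratfun) \<Rightarrow> 'i \<Rightarrow> 'k ratfun" where
  "form_mult f \<omega> = (\<lambda>i. f * \<omega> i)"

definition form_scale :: "('k::field) \<Rightarrow> 'k form1 \<Rightarrow> 'k form1" where
  "form_scale c = form_mult (const c)"

lemma const_add: "const (a + b) = const a + const b"
  by (simp add: const_def single_add)

lemma const_mult: "const (a * b) = const a * const b"
  by (simp add: const_def mult_single flip: to_fract_mult)

lemma const_1 [simp]: "const 1 = 1"
  by (simp add: const_def)

global_interpretation form: vector_space form_scale
  by standard
    (auto simp: form_scale_def form_mult_def const_add const_mult fun_eq_iff algebra_simps)

section \<open>Arrangements and logarithmic forms\<close>

definition coord_space :: "nat \<Rightarrow> (nat \<Rightarrow> 'k::field) set" where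
  "coord_space l = {1..l} \<rightarrow>\<^sub>E UNIV"

text \<open>
  A linear form \<open>\<Sum>i. c i x\<^sub>i\<close> on \<open>\<K>\<^sup>l\<close> is given by \<open>c\<close>; the values of \<open>c\<close> outside \<open>{1..l}\<close>
  are irrelevant.
\<close>

definition is_defining_form :: "nat \<Rightarrow> (nat \<Rightarrow> 'k::field) \<Rightarrow> (nat \<Rightarrow> 'k) set \<Rightarrow> bool" where
  "is_defining_form l c H \<longleftrightarrow>
     (\<exists>i\<in>{1..l}. c i \<noteq> 0) \<and> H = {v \<in> coord_space l. (\<Sum>i=1..l. c i * v i) = 0}"

definition linear_poly :: "nat \<Rightarrow> (nat \<Rightarrow> 'k::field) \<Rightarrow> 'k mpoly" where
  "linear_poly l c = (\<Sum>i=1..l. Poly_Mapping.single (Poly_Mapping.single i 1) (c i))"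

definition d_linear :: "nat \<Rightarrow> (nat \<Rightarrow> 'k::field) \<Rightarrow> 'k form1" where
  "d_linear l c = (\<lambda>i. if i \<in> {1..l} then const (c i) else 0)"

text \<open>
  In the following, \<open>\<alpha> H\<close> is (the coefficient function of) a defining form of the hyperplane \<open>H\<close>.
\<close>

definition defining_poly ::
    "nat \<Rightarrow> ((nat \<Rightarrow> 'k::field) set \<Rightarrow> nat \<Rightarrow> 'k) \<Rightarrow> (nat \<Rightarrow> 'k) set set \<Rightarrow> 'k mpoly" where
  "defining_poly l \<alpha> \<A> = (\<Prod>H\<in>\<A>. linear_poly l (\<alpha> H))"

definition log_forms ::
    "nat \<Rightarrow> ((nat \<Rightarrow> 'k::field) set \<Rightarrow> nat \<Rightarrow> 'k) \<Rightarrow> (nat \<Rightarrow> 'k) set set \<Rightarrow> 'k form1 set" where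
  "log_forms l \<alpha> \<A> =
     {\<omega> \<in> form_mult (1 / to_fract (defining_poly l \<alpha> \<A>)) ` Omega1 l.
        \<forall>H\<in>\<A>. wedge (form_mult (to_fract (defining_poly l \<alpha> \<A>)) \<omega>) (d_linear l (\<alpha> H))
                \<in> form_mult (to_fract (linear_poly l (\<alpha> H))) ` Omega2 l}"

section \<open>Hilbert series\<close>

definition graded_part :: "('k::field) form1 set \<Rightarrow> int \<Rightarrow> 'k form1 set" where
  "graded_part M d = {\<omega> \<in> M. \<forall>i. homogeneous_ratfun d (\<omega> i)}"

text \<open>
  \<open>Hilb M\<close> is meaningful only if every graded part is finite-dimensional (\<open>form.dim\<close> is \<open>0\<close>
  otherwise) and the graded parts vanish in all sufficiently negative degrees.
\<close>

definition Hilb_defined :: "('k::field) form1 set \<Rightarrow> bool" where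
  "Hilb_defined M \<longleftrightarrow>
     (\<forall>d. \<exists>B. finite B \<and> graded_part M d \<subseteq> form.span B)
     \<and> (\<forall>\<^sub>\<infinity>n::nat. graded_part M (- int n) \<subseteq> {0})"

definition Hilb :: "('k::field) form1 set \<Rightarrow> rat fls" where
  "Hilb M = Abs_fls (\<lambda>d. of_nat (form.dim (graded_part M d)))"

section \<open>Graphs\<close>

text \<open>A simple graph on the vertex set \<open>{1..l}\<close> is given by its set \<open>E\<close> of two-element edges.\<close>

definition graphic_arrangement :: "nat \<Rightarrow> nat set set \<Rightarrow> (nat \<Rightarrow> 'k::field) set set" where
  "graphic_arrangement l E = {{x \<in> coord_space l. x u = x v} | u v. {u, v} \<in> E}"

definition clique_complex :: "nat \<Rightarrow> nat set set \<Rightarrow> nat set set" where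
  "clique_complex l E = {F. F \<subseteq> {1..l} \<and> clique F E}"

end

theory Submission
  imports Defs
begin

text \<open>
  Order the vertices, and let \<open>N\<close> be the set of neighbours of \<open>v\<close> below \<open>v\<close>. If all coefficients of a
  logarithmic form above \<open>v\<close> vanish, then its coefficient at \<open>v\<close> is
  \<open>p / \<Prod>\<^bsub>j\<in>N\<^esub> (x\<^sub>v - x\<^sub>j)\<close> for a polynomial \<open>p\<close> that vanishes on \<open>x\<^sub>i = x\<^sub>j = x\<^sub>v\<close> for all
  non-adjacent \<open>i, j \<in> N\<close>. In the coordinates \<open>x\<^sub>v\<close> and \<open>x\<^sub>v - x\<^sub>j\<close> this means that every monomial of
  \<open>p\<close> omits only a clique of \<open>N\<close>. Conversely, every clique \<open>F\<close> gives the logarithmic form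
  \<open>\<Sum>\<^bsub>i\<in>F\<^esub> dx\<^sub>i / \<Prod>\<^bsub>j\<in>F-{i}\<^esub> (x\<^sub>i - x\<^sub>j)\<close> of degree \<open>1 - #F\<close>. For \<open>v = Max F\<close>, its multiples by the
  monomials in the shifted coordinates whose index lies outside \<open>F - {v}\<close> have leading coefficients
  that account for each of these monomials of \<open>p\<close> exactly once. By triangularity they form a basis
  of \<open>\<Omega>\<^sup>1(\<A>\<^sub>G)\<close>, and \<open>F\<close> contributes \<open>t\<^bsup>1-#F\<^esup> / (1-t)\<^bsup>l-#F+1\<^esup>\<close> to the Hilbert series.
\<close>

section \<open>Substitution in polynomials\<close>

abbreviation (input) "lookup \<equiv> Poly_Mapping.lookup"
abbreviation (input) "keys \<equiv> Poly_Mapping.keys"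
abbreviation (input) "single \<equiv> Poly_Mapping.single"

definition Var :: "nat \<Rightarrow> ('k::field) mpoly" where
  "Var i = single (single i 1) 1"

definition monom_eval :: "(nat \<Rightarrow> ('k::field) mpoly) \<Rightarrow> (nat \<Rightarrow>\<^sub>0 nat) \<Rightarrow> 'k mpoly" where
  "monom_eval f m = (\<Prod>i\<in>keys m. f i ^ lookup m i)"

text \<open>The endomorphism of the polynomial algebra over K that maps x_i to \<open>f i\<close>.
  Coordinate changes, restriction to a hyperplane and the projection onto S are all instances of
  it.\<close>

definition subst :: "(nat \<Rightarrow> ('k::field) mpoly) \<Rightarrow> 'k mpoly \<Rightarrow> 'k mpoly" where
  "subst f p = (\<Sum>m\<in>keys p. single 0 (lookup p m) * monom_eval f m)"

lemma keys_add_nat: "keys (m + n) = keys m \<union> keys (n :: nat \<Rightarrow>\<^sub>0 nat)"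
  by (auto simp: in_keys_iff lookup_add)

lemma monom_eval_superset:
  assumes "finite A" "keys m \<subseteq> A"
  shows "monom_eval f m = (\<Prod>i\<in>A. f i ^ lookup m i)"
  unfolding monom_eval_def using assms
  by (intro prod.mono_neutral_left) (auto simp: in_keys_iff)

lemma monom_eval_add: "monom_eval f (m + n) = monom_eval f m * monom_eval f n"
proof -
  have "monom_eval f m = (\<Prod>i\<in>keys m \<union> keys n. f i ^ lookup m i)"
    "monom_eval f n = (\<Prod>i\<in>keys m \<union> keys n. f i ^ lookup n i)"
    "monom_eval f (m + n) = (\<Prod>i\<in>keys m \<union> keys n. f i ^ lookup (m + n) i)"
    by (intro monom_eval_superset; auto simp: keys_add_nat)+
  then show ?thesis by (simp add: lookup_add power_add prod.distrib)
qed

lemma monom_eval_0 [simp]: "monom_eval f 0 = 1"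
  by (simp add: monom_eval_def)

lemma subst_superset:
  assumes "finite A" "keys p \<subseteq> A"
  shows "subst f p = (\<Sum>m\<in>A. single 0 (lookup p m) * monom_eval f m)"
  unfolding subst_def using assms
  by (intro sum.mono_neutral_left) (auto simp: in_keys_iff)

lemma subst_add [simp]: "subst f (p + q) = subst f p + subst f q"
proof -
  let ?A = "keys p \<union> keys q"
  have "subst f p = (\<Sum>m\<in>?A. single 0 (lookup p m) * monom_eval f m)"
    "subst f q = (\<Sum>m\<in>?A. single 0 (lookup q m) * monom_eval f m)"
    "subst f (p + q) = (\<Sum>m\<in>?A. single 0 (lookup (p + q) m) * monom_eval f m)"
    using keys_add[of p q] by (intro subst_superset; auto)+
  then show ?thesis
    by (simp add: lookup_add single_add distrib_right sum.distrib)
qed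

lemma subst_single: "subst f (single m c) = single 0 c * monom_eval f m"
  by (simp add: subst_def)

lemma subst_0 [simp]: "subst f 0 = 0"
  by (simp add: subst_def)

lemma subst_1 [simp]: "subst f 1 = 1"
  unfolding single_one[symmetric] subst_single by (simp add: single_one)

lemma subst_const [simp]: "subst f (single 0 c) = single 0 c"
  by (simp add: subst_single)

lemma subst_Var [simp]: "subst f (Var i) = f i"
  by (simp add: Var_def subst_single monom_eval_def single_one)

text \<open>Without the freshness condition of \<open>update_induct\<close>, this reduces claims
  that are additive in \<open>p\<close> to single terms.\<close>

lemma poly_mapping_add_induct [case_names zero add]:
  assumes "P 0" "\<And>m c p. P p \<Longrightarrow> P (single m c + p)"
  shows "P (p :: 'a \<Rightarrow>\<^sub>0 'b::comm_monoid_add)"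
proof (induction p rule: update_induct)
  case const
  show ?case using assms(1) by simp
next
  case (update f a b)
  then have "Poly_Mapping.update a b f = single a b + f"
    by (intro poly_mapping_eqI)
      (auto simp: lookup_update lookup_add lookup_single in_keys_iff when_def)
  then show ?case using update assms(2) by simp
qed

lemma subst_mult [simp]: "subst f (p * q) = subst f p * subst f q"
proof (induction p rule: poly_mapping_add_induct)
  case (add m c p)
  have "subst f (single m c * q) = subst f (single m c) * subst f q"
    by (induction q rule: poly_mapping_add_induct)
      (simp_all add: distrib_left mult_single subst_single monom_eval_add mult_ac
        flip: mult_single[of 0 _ 0, simplified])
  then show ?case using add by (simp add: distrib_right)
qed simp

lemma subst_uminus [simp]: "subst f (- p) = - subst f p"
  by (metis add.right_inverse add_eq_0_iff subst_0 subst_add)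

lemma subst_diff [simp]: "subst f (p - q) = subst f p - subst f q"
  by (metis diff_conv_add_uminus subst_add subst_uminus)

lemma subst_sum [simp]: "subst f (sum g A) = (\<Sum>x\<in>A. subst f (g x))"
  by (induction A rule: infinite_finite_induct) auto

lemma subst_prod [simp]: "subst f (prod g A) = (\<Prod>x\<in>A. subst f (g x))"
  by (induction A rule: infinite_finite_induct) auto

lemma subst_power [simp]: "subst f (p ^ n) = subst f p ^ n"
  by (induction n) auto

lemma subst_subst: "subst f (subst g p) = subst (\<lambda>i. subst f (g i)) p"
  by (induction p rule: poly_mapping_add_induct) (simp_all add: subst_single monom_eval_def)

lemma Var_power: "Var i ^ n = single (single i n) 1"
  by (induction n) (simp_all add: single_one mult_single Var_def flip: single_add)

lemma prod_single: "(\<Prod>i\<in>A. single (g i) (1::'k::field)) = single (\<Sum>i\<in>A. g i :: nat \<Rightarrow>\<^sub>0 nat) 1"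
  by (induction A rule: infinite_finite_induct) (simp_all add: single_one mult_single)

lemma sum_single_lookup: "(\<Sum>i\<in>keys m. single i (lookup m i)) = (m :: nat \<Rightarrow>\<^sub>0 nat)"
  by (intro poly_mapping_eqI) (auto simp: lookup_sum lookup_single when_def sum.delta in_keys_iff)

lemma monom_eval_Var: "monom_eval Var m = single m 1"
  by (simp add: monom_eval_def Var_power prod_single sum_single_lookup)

lemma subst_Var_id [simp]: "subst Var p = p"
  by (induction p rule: poly_mapping_add_induct)
    (simp_all add: subst_single monom_eval_Var mult_single)

section \<open>Divisibility by differences of variables\<close>

lemma dvd_prod_diff:
  assumes "\<And>i. i \<in> A \<Longrightarrow> d dvd (f i - g i :: 'a::comm_ring_1)"
  shows "d dvd prod f A - prod g A"
  using assms
proof (induction A rule: infinite_finite_induct)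
  case (insert x A)
  \<comment> \<open>Telescoping: one factor of the product is exchanged at a time.\<close>
  have "prod f (insert x A) - prod g (insert x A)
      = f x * (prod f A - prod g A) + (f x - g x) * prod g A"
    using insert by (simp add: algebra_simps)
  then show ?case using insert by simp
qed auto

text \<open>Congruences modulo \<open>d\<close> pass through sums and products, hence through the
  evaluation of a polynomial.\<close>

lemma dvd_subst_diff:
  assumes "\<And>i. d dvd f i - g i"
  shows "d dvd subst f p - subst g p"
proof (induction p rule: poly_mapping_add_induct)
  case (add m c p)
  have "d dvd f i ^ n - g i ^ n" for i n
    using assms[of i] dvd_prod_diff[of "{..<n}" d "\<lambda>_. f i" "\<lambda>_. g i"] by simp
  then have "d dvd monom_eval f m - monom_eval g m"
    unfolding monom_eval_def by (intro dvd_prod_diff) auto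
  then have "d dvd subst f (single m c) - subst g (single m c)"
    by (simp add: subst_single flip: right_diff_distrib)
  then have "d dvd (subst f (single m c) - subst g (single m c)) + (subst f p - subst g p)"
    using add by (rule dvd_add)
  then show ?case by (simp add: algebra_simps)
qed simp

text \<open>Factor theorem: the right side says that \<open>p\<close> vanishes on the hyperplane x_u
  = x_v. Since substitution is a ring homomorphism into a domain, factors that do not vanish there
  can be cancelled from a divisibility.\<close>

lemma Var_diff_dvd_iff:
  "Var u - Var v dvd p \<longleftrightarrow> subst (Var(u := Var v)) p = 0"
proof
  assume "subst (Var(u := Var v)) p = 0"
  moreover have "Var u - Var v dvd subst Var p - subst (Var(u := Var v)) p"
    by (rule dvd_subst_diff) auto
  ultimately show "Var u - Var v dvd p" by simp
next
  assume "Var u - Var v dvd p"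
  then obtain r where "p = (Var u - Var v) * r" ..
  then show "subst (Var(u := Var v)) p = 0" by simp
qed

lemma Var_eq_iff [simp]: "Var u = (Var v :: 'k::field mpoly) \<longleftrightarrow> u = v"
proof
  assume "Var u = (Var v :: 'k mpoly)"
  then have "lookup (Var u :: 'k mpoly) (single v 1) = 1" by (simp add: Var_def)
  then have "single u (1::nat) = single v 1"
    by (simp add: Var_def lookup_single when_def split: if_splits)
  then have "lookup (single u (1::nat)) v = 1" by simp
  then show "u = v" by (simp add: lookup_single when_def split: if_splits)
qed simp

lemma Var_nonzero [simp]: "Var i \<noteq> 0"
proof
  assume "Var i = (0 :: 'a mpoly)"
  then have "lookup (Var i :: 'a mpoly) (single i 1) = 0" by simp
  then show False by (simp add: Var_def)
qed

section \<open>Deleting variables, and the subring S\<close>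

lemma lookup_subst_zero:
  fixes p :: "('k::field) mpoly"
  shows "lookup (subst (\<lambda>i. if i \<in> A then 0 else Var i) p) m = (if keys m \<inter> A = {} then lookup p m else 0)"
proof (induction p rule: poly_mapping_add_induct)
  case (add n c p)
  let ?f = "\<lambda>i. if i \<in> A then 0 else Var i :: 'k mpoly"
  have "subst ?f (single n c) = (if keys n \<inter> A = {} then single n c else 0)"
  proof (cases "keys n \<inter> A = {}")
    case True
    then have "monom_eval ?f n = monom_eval Var n"
      unfolding monom_eval_def by (intro prod.cong) auto
    then show ?thesis using True by (simp add: subst_single monom_eval_Var mult_single)
  next
    case False
    then obtain i where "i \<in> keys n" "i \<in> A" by auto
    then have "monom_eval ?f n = 0"
      unfolding monom_eval_def by (intro prod_zero) (auto simp: in_keys_iff intro!: bexI[of _ i])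
    then show ?thesis using False by (simp add: subst_single)
  qed
  then show ?case using add by (auto simp: lookup_add lookup_single when_def)
qed simp

text \<open>S appears as the fixed points of the endomorphism that kills the variables outside
  \<open>{1..l}\<close>, so closure under the ring operations is immediate.\<close>

lemma poly_ring_iff_subst:
  "p \<in> poly_ring l \<longleftrightarrow> subst (\<lambda>i. if i \<in> - {1..l} then 0 else Var i) p = p"
  (is "_ \<longleftrightarrow> ?r p = p")
proof -
  have "?r p = p \<longleftrightarrow> (\<forall>m. keys m \<inter> - {1..l} \<noteq> {} \<longrightarrow> lookup p m = 0)"
    by (subst poly_mapping_eq_iff, unfold fun_eq_iff lookup_subst_zero) auto
  also have "\<dots> \<longleftrightarrow> (\<forall>m. lookup p m \<noteq> 0 \<longrightarrow> keys m \<subseteq> {1..l})"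
    by blast
  also have "\<dots> \<longleftrightarrow> p \<in> poly_ring l"
    by (simp add: poly_ring_def Ball_def in_keys_iff[of _ p])
  finally show ?thesis ..
qed

lemma poly_ring_0 [simp]: "0 \<in> poly_ring l"
  and poly_ring_1 [simp]: "1 \<in> poly_ring l"
  and poly_ring_const [simp]: "single 0 c \<in> poly_ring l"
  by (simp_all add: poly_ring_iff_subst)

lemma poly_ring_Var: "i \<in> {1..l} \<Longrightarrow> Var i \<in> poly_ring l"
  by (simp add: poly_ring_iff_subst)

lemma poly_ring_add: "p \<in> poly_ring l \<Longrightarrow> q \<in> poly_ring l \<Longrightarrow> p + q \<in> poly_ring l"
  and poly_ring_diff: "p \<in> poly_ring l \<Longrightarrow> q \<in> poly_ring l \<Longrightarrow> p - q \<in> poly_ring l"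
  and poly_ring_mult: "p \<in> poly_ring l \<Longrightarrow> q \<in> poly_ring l \<Longrightarrow> p * q \<in> poly_ring l"
  unfolding poly_ring_iff_subst by simp_all

lemma poly_ring_sum: "(\<And>i. i \<in> A \<Longrightarrow> f i \<in> poly_ring l) \<Longrightarrow> sum f A \<in> poly_ring l"
  by (induction A rule: infinite_finite_induct) (auto intro: poly_ring_add)

lemma poly_ring_prod: "(\<And>i. i \<in> A \<Longrightarrow> f i \<in> poly_ring l) \<Longrightarrow> prod f A \<in> poly_ring l"
  by (induction A rule: infinite_finite_induct) (auto intro: poly_ring_mult)

text \<open>If \<open>r\<close> is the endomorphism killing the other variables, then
  \<open>p * r q = r (p * q) = p * q\<close>, and \<open>p\<close> cancels. This keeps quotients
  found in the ambient ring inside S.\<close>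

lemma poly_ring_cancel:
  assumes "p * q \<in> poly_ring l" "p \<in> poly_ring l" "p \<noteq> 0"
  shows "q \<in> poly_ring l"
  using assms unfolding poly_ring_iff_subst by simp

lemma poly_ring_subst:
  assumes "p \<in> poly_ring l" "\<And>i. i \<in> {1..l} \<Longrightarrow> f i \<in> poly_ring l"
  shows "subst f p \<in> poly_ring l"
proof -
  have *: "f i ^ n \<in> poly_ring l" if "i \<in> {1..l}" for i n
    using poly_ring_prod[of "{..<n}" "\<lambda>_. f i" l] assms(2)[OF that] by simp
  have "i \<in> {1..l}" if "m \<in> keys p" "i \<in> keys m" for m i
    using assms(1) that unfolding poly_ring_def by blast
  then show ?thesis
    unfolding subst_def monom_eval_def
    by (intro poly_ring_sum poly_ring_mult poly_ring_prod *) auto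
qed

section \<open>Homogeneity\<close>

lemma monomial_degree_superset:
  assumes "finite A" "keys m \<subseteq> A"
  shows "monomial_degree m = (\<Sum>i\<in>A. lookup m i)"
  unfolding monomial_degree_def using assms
  by (intro sum.mono_neutral_left) (auto simp: in_keys_iff)

lemma monomial_degree_add [simp]:
  "monomial_degree (m + n) = monomial_degree m + monomial_degree n"
proof -
  have "monomial_degree m = (\<Sum>i\<in>keys m \<union> keys n. lookup m i)"
    "monomial_degree n = (\<Sum>i\<in>keys m \<union> keys n. lookup n i)"
    "monomial_degree (m + n) = (\<Sum>i\<in>keys m \<union> keys n. lookup (m + n) i)"
    by (intro monomial_degree_superset; auto simp: keys_add_nat)+
  then show ?thesis by (simp add: lookup_add sum.distrib)
qed

lemma monomial_degree_single [simp]: "monomial_degree (single i n) = n"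
  by (simp add: monomial_degree_def)

lemma monomial_degree_0 [simp]: "monomial_degree 0 = 0"
  by (simp add: monomial_degree_def)

lemma homogeneous_0 [simp]: "homogeneous n 0"
  by (simp add: homogeneous_def)

lemma homogeneous_single: "homogeneous (monomial_degree m) (single m c)"
  by (simp add: homogeneous_def)

lemma homogeneous_1: "homogeneous 0 1"
  using homogeneous_single[of 0 1] by (simp add: single_one)

lemma homogeneous_const: "homogeneous 0 (single 0 c)"
  using homogeneous_single[of 0 c] by simp

lemma homogeneous_Var: "homogeneous 1 (Var i)"
  by (simp add: homogeneous_def Var_def)

lemma homogeneous_add: "homogeneous n p \<Longrightarrow> homogeneous n q \<Longrightarrow> homogeneous n (p + q)"
  using keys_add[of p q] unfolding homogeneous_def by blast

lemma keys_uminus: "keys (- p) = keys (p :: 'k::field mpoly)"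
  by (auto simp: in_keys_iff)

lemma homogeneous_uminus: "homogeneous n p \<Longrightarrow> homogeneous n (- p)"
  by (simp add: homogeneous_def keys_uminus)

lemma homogeneous_diff: "homogeneous n p \<Longrightarrow> homogeneous n q \<Longrightarrow> homogeneous n (p - q)"
  using homogeneous_add[of n p "- q"] homogeneous_uminus[of n q] by simp

lemma homogeneous_mult: "homogeneous m p \<Longrightarrow> homogeneous n q \<Longrightarrow> homogeneous (m + n) (p * q)"
  using keys_mult[of p q] unfolding homogeneous_def by fastforce

lemma homogeneous_sum: "(\<And>i. i \<in> A \<Longrightarrow> homogeneous n (f i)) \<Longrightarrow> homogeneous n (sum f A)"
  by (induction A rule: infinite_finite_induct) (auto intro: homogeneous_add)

lemma homogeneous_prod:
  "(\<And>i. i \<in> A \<Longrightarrow> homogeneous (g i) (f i)) \<Longrightarrow> homogeneous (sum g A) (prod f A)"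
  by (induction A rule: infinite_finite_induct) (auto intro: homogeneous_mult homogeneous_1)

lemma homogeneous_power: "homogeneous n p \<Longrightarrow> homogeneous (k * n) (p ^ k)"
  using homogeneous_prod[of "{..<k}" "\<lambda>_. n" "\<lambda>_. p"] by simp

lemma homogeneous_subst:
  assumes "homogeneous n p" "\<And>i. homogeneous 1 (f i)"
  shows "homogeneous n (subst f p)"
  unfolding subst_def
proof (rule homogeneous_sum)
  fix m assume "m \<in> keys p"
  then have n: "monomial_degree m = n" using assms(1) by (simp add: homogeneous_def)
  have "homogeneous k (f i ^ k)" for i k
    using homogeneous_power[OF assms(2)] by simp
  then have "homogeneous (monomial_degree m) (monom_eval f m)"
    unfolding monomial_degree_def monom_eval_def by (intro homogeneous_prod)
  then have "homogeneous (0 + n) (single 0 (lookup p m) * monom_eval f m)"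
    unfolding n by (intro homogeneous_mult homogeneous_const)
  then show "homogeneous n (single 0 (lookup p m) * monom_eval f m)" by simp
qed

lemma poly_eq_sum_single: "p = (\<Sum>b\<in>keys p. single b (lookup p b))"
  by (intro poly_mapping_eqI)
    (auto simp: lookup_sum lookup_single when_def sum.delta in_keys_iff)

text \<open>The part of \<open>p\<close> in the wrong degrees, times \<open>q\<close>, has no term
  of degree \<open>m\<close>, yet it is a difference of two polynomials homogeneous of degree
  \<open>m\<close>; so it vanishes. The additive form avoids a truncated
  \<open>m - n\<close>.\<close>

lemma homogeneous_cancel:
  fixes p q :: "('k::field) mpoly"
  assumes pq: "homogeneous m (p * q)" and q: "homogeneous n q" "q \<noteq> 0"
    and b: "b \<in> keys p"
  shows "monomial_degree b + n = m"
proof -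
  define part where "part = (\<lambda>B. \<Sum>b\<in>B. single b (lookup p b))"
  let ?B = "{b \<in> keys p. monomial_degree b + n = m}" and ?C = "{b \<in> keys p. monomial_degree b + n \<noteq> m}"
  have "part (keys p) = p"
    unfolding part_def by (rule poly_eq_sum_single[symmetric])
  moreover have "part (?B \<union> ?C) = part ?B + part ?C"
    unfolding part_def by (rule sum.union_disjoint) auto
  moreover have "?B \<union> ?C = keys p" by auto
  ultimately have p: "p = part ?B + part ?C" by simp
  have keys_part: "keys (part B) \<subseteq> B" if "finite B" for B
  proof
    fix b assume "b \<in> keys (part B)"
    then show "b \<in> B"
      using that by (auto simp: part_def in_keys_iff lookup_sum lookup_single when_def sum.delta split: if_splits)
  qed
  have "homogeneous m (part ?B * q)"
    using keys_mult[of "part ?B" q] keys_part[of ?B] q(1) unfolding homogeneous_def by fastforce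
  then have "homogeneous m (p * q - part ?B * q)"
    by (rule homogeneous_diff[OF pq])
  moreover have "p * q - part ?B * q = part ?C * q"
    by (subst (1) p) (simp add: algebra_simps)
  ultimately have "\<forall>k\<in>keys (part ?C * q). monomial_degree k = m"
    by (simp add: homogeneous_def)
  moreover have "\<forall>k\<in>keys (part ?C * q). monomial_degree k \<noteq> m"
    using keys_mult[of "part ?C" q] keys_part[of ?C] q(1) unfolding homogeneous_def by fastforce
  ultimately have "keys (part ?C * q) = {}" by blast
  then have "part ?C = 0" using q(2) by simp
  then have "p = part ?B" using p by simp
  then have "b \<in> ?B" using keys_part[of ?B] b by auto
  then show ?thesis by simp
qed

section \<open>Homogeneous rational functions\<close>

lemma homogeneous_ratfunI:
  assumes "homogeneous m p" "homogeneous n q" "q \<noteq> 0" "d = int m - int n"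
  shows "homogeneous_ratfun d (to_fract p / to_fract q)"
  unfolding homogeneous_ratfun_def Fract_conv_to_fract using assms by blast

lemma homogeneous_ratfunE:
  assumes "homogeneous_ratfun d f"
  obtains p q m n where "homogeneous m p" "homogeneous n q" "q \<noteq> 0"
    "f = to_fract p / to_fract q" "d = int m - int n"
  using assms unfolding homogeneous_ratfun_def Fract_conv_to_fract by blast

lemma homogeneous_ratfun_0: "homogeneous_ratfun d (0 :: ('a::field) ratfun)"
proof -
  have h: "homogeneous k (Var 1 ^ k :: 'a mpoly)" for k
    using homogeneous_power[OF homogeneous_Var] by simp
  \<comment> \<open>The degrees of numerator and denominator are the positive and the negative part
    of \<open>d\<close>; the numerator 0 has any degree required.\<close>
  have "homogeneous_ratfun d (to_fract 0 / to_fract (Var 1 ^ nat (-d) :: 'a mpoly))"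
    by (rule homogeneous_ratfunI[OF homogeneous_0 h, where m="nat d"]) auto
  then show ?thesis by simp
qed

lemma homogeneous_ratfun_mult:
  assumes "homogeneous_ratfun d f" "homogeneous_ratfun e g"
  shows "homogeneous_ratfun (d + e) (f * g)"
proof -
  obtain p q m n where 1: "homogeneous m p" "homogeneous n q" "q \<noteq> 0"
    "f = to_fract p / to_fract q" "d = int m - int n"
    using assms(1) by (rule homogeneous_ratfunE)
  obtain p' q' m' n' where 2: "homogeneous m' p'" "homogeneous n' q'" "q' \<noteq> 0"
    "g = to_fract p' / to_fract q'" "e = int m' - int n'"
    using assms(2) by (rule homogeneous_ratfunE)
  have "f * g = to_fract (p * p') / to_fract (q * q')" using 1 2 by simp
  also have "homogeneous_ratfun (d + e) \<dots>"
    by (rule homogeneous_ratfunI[OF homogeneous_mult[OF 1(1) 2(1)] homogeneous_mult[OF 1(2) 2(2)]])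
      (use 1 2 in auto)
  finally show ?thesis .
qed

lemma homogeneous_ratfun_add:
  assumes "homogeneous_ratfun d f" "homogeneous_ratfun d g"
  shows "homogeneous_ratfun d (f + g)"
proof -
  obtain p q m n where 1: "homogeneous m p" "homogeneous n q" "q \<noteq> 0"
    "f = to_fract p / to_fract q" "d = int m - int n"
    using assms(1) by (rule homogeneous_ratfunE)
  obtain p' q' m' n' where 2: "homogeneous m' p'" "homogeneous n' q'" "q' \<noteq> 0"
    "g = to_fract p' / to_fract q'" "d = int m' - int n'"
    using assms(2) by (rule homogeneous_ratfunE)
  \<comment> \<open>Equal total degrees give the cross products \<open>p * q'\<close> and
    \<open>q * p'\<close> the same degree.\<close>
  have "n + m' = m + n'" using 1(5) 2(5) by linarith
  then have "homogeneous (m + n') (q * p')"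
    using homogeneous_mult[OF 1(2) 2(1)] by simp
  then have h: "homogeneous (m + n') (p * q' + q * p')"
    by (intro homogeneous_add homogeneous_mult[OF 1(1) 2(2)])
  have "f + g = to_fract (p * q' + q * p') / to_fract (q * q')"
    using 1 2 by (simp add: field_simps)
  also have "homogeneous_ratfun d \<dots>"
    by (rule homogeneous_ratfunI[OF h homogeneous_mult[OF 1(2) 2(2)]]) (use 1 2 in auto)
  finally show ?thesis .
qed

lemma homogeneous_ratfun_const: "homogeneous_ratfun 0 (const c)"
  using homogeneous_ratfunI[OF homogeneous_const homogeneous_1, of 0 c] by (simp add: const_def)

text \<open>The fraction witnessing homogeneity may differ from \<open>p / q\<close>;
  cross-multiplying and cancelling its homogeneous denominator transfers the degree to the given
  numerator.\<close>

lemma homogeneous_ratfun_cancel: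
  assumes "homogeneous_ratfun d (to_fract p / to_fract q)" "homogeneous n q" "q \<noteq> 0"
    and "b \<in> keys p"
  shows "int (monomial_degree b) = d + int n"
proof -
  obtain p' q' m' n' where 1: "homogeneous m' p'" "homogeneous n' q'" "q' \<noteq> 0"
    "to_fract p / to_fract q = to_fract p' / to_fract q'" "d = int m' - int n'"
    using assms(1) by (rule homogeneous_ratfunE)
  have "to_fract (p * q') = to_fract (p' * q)"
    using 1(3,4) assms(3) by (simp add: field_simps)
  then have "p * q' = p' * q" by (simp only: to_fract_eq_iff)
  then have "homogeneous (m' + n) (p * q')" using homogeneous_mult[OF 1(1) assms(2)] by simp
  from homogeneous_cancel[OF this 1(2,3) assms(4)] 1(5) show ?thesis by linarith
qed

section \<open>Counting monomials\<close>

definition exponents :: "nat set \<Rightarrow> nat \<Rightarrow> (nat \<Rightarrow>\<^sub>0 nat) set" where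
  "exponents A n = {b. keys b \<subseteq> A \<and> monomial_degree b = n}"

text \<open>A monomial either omits \<open>a\<close> or is x_a times a monomial of degree one less;
  for \<open>n = 0\<close> only the former can happen. This recursion produces the factors
  1/(1-t).\<close>

lemma exponents_insert:
  assumes "a \<notin> A"
  shows "exponents (insert a A) n = exponents A n \<union>
    (if n = 0 then {} else (\<lambda>b. b + single a 1) ` exponents (insert a A) (n - 1))"
    (is "?L = ?R")
proof (intro equalityI subsetI)
  fix b assume b: "b \<in> ?L"
  show "b \<in> ?R"
  proof (cases "a \<in> keys b")
    case True
    define b' where "b' = b - single a 1"
    have bb': "b = b' + single a 1"
      using True unfolding b'_def
      by (intro poly_mapping_eqI) (auto simp: lookup_add lookup_minus lookup_single when_def in_keys_iff)
    then have "b' \<in> exponents (insert a A) (n - 1)" "n \<noteq> 0"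
      using b by (auto simp: exponents_def keys_add_nat)
    then show ?thesis using bb' by auto
  next
    case False
    then show ?thesis using b by (auto simp: exponents_def)
  qed
next
  fix b assume "b \<in> ?R"
  then show "b \<in> ?L" by (auto simp: exponents_def keys_add_nat split: if_splits)
qed

lemma exponents_insert_disjoint:
  assumes "a \<notin> A"
  shows "exponents A n \<inter> (\<lambda>b. b + single a 1) ` B = {}"
  using assms by (auto simp: exponents_def keys_add_nat)

lemma exponents_empty: "exponents {} n = (if n = 0 then {0} else {})"
  by (auto simp: exponents_def)

lemma finite_exponents [simp]: "finite A \<Longrightarrow> finite (exponents A n)"
proof (induction A arbitrary: n rule: finite_induct)
  case (insert a A)
  show ?case by (induction n) (use insert in \<open>simp_all add: exponents_insert[of a A]\<close>)
qed (simp add: exponents_empty)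

definition hilbert_fps :: "nat set \<Rightarrow> rat fps" where
  "hilbert_fps A = Abs_fps (\<lambda>n. of_nat (card (exponents A n)))"

lemma hilbert_fps_insert:
  assumes "finite A" "a \<notin> A"
  shows "hilbert_fps (insert a A) = hilbert_fps A + fps_X * hilbert_fps (insert a A)"
proof (rule fps_ext)
  fix n
  show "fps_nth (hilbert_fps (insert a A)) n = fps_nth (hilbert_fps A + fps_X * hilbert_fps (insert a A)) n"
  proof (cases n)
    case 0
    then show ?thesis using exponents_insert[OF assms(2), of 0] by (simp add: hilbert_fps_def)
  next
    case (Suc m)
    have "card (exponents (insert a A) n) = card (exponents A n)
        + card ((\<lambda>b. b + single a 1) ` exponents (insert a A) m)"
      using assms Suc
      by (subst exponents_insert[OF assms(2)], simp, subst card_Un_disjoint)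
        (simp_all add: exponents_insert_disjoint[simplified])
    also have "card ((\<lambda>b. b + single a 1) ` exponents (insert a A) m) = card (exponents (insert a A) m)"
      by (rule card_image) (simp add: inj_on_def)
    finally show ?thesis using Suc by (simp add: hilbert_fps_def)
  qed
qed

text \<open>This is the Hilbert series of a polynomial ring: each new variable contributes a factor
  1/(1-t). The product form keeps division out of the power series.\<close>

lemma hilbert_fps_mult: "finite A \<Longrightarrow> hilbert_fps A * (1 - fps_X) ^ card A = 1"
proof (induction A rule: finite_induct)
  case empty
  show ?case by (rule fps_ext) (simp add: hilbert_fps_def exponents_empty)
next
  case (insert a A)
  have "hilbert_fps (insert a A) * (1 - fps_X) = hilbert_fps A"
    using hilbert_fps_insert[OF insert(1,2)] by (simp add: algebra_simps)
  moreover have "hilbert_fps (insert a A) * (1 - fps_X) ^ card (insert a A)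
      = (hilbert_fps (insert a A) * (1 - fps_X)) * (1 - fps_X) ^ card A"
    using insert by (simp add: mult_ac)
  ultimately show ?case using insert by simp
qed

text \<open>The shift by \<open>k\<close> is taken in Laurent series, since the degrees
  \<open>1 - card F\<close> of the clique forms may be negative.\<close>

lemma fls_nth_exponents:
  assumes "finite A"
  shows "fls_nth (fls_X powi k / (1 - fls_X) ^ card A :: rat fls) d =
    (if d < k then 0 else of_nat (card (exponents A (nat (d - k)))))"
proof -
  have "fps_to_fls (hilbert_fps A) * fps_to_fls ((1 - fps_X) ^ card A) = (1 :: rat fls)"
    using hilbert_fps_mult[OF assms] by (simp flip: fls_times_fps_to_fls)
  then have "fps_to_fls (hilbert_fps A) * (1 - fls_X) ^ card A = 1"
    by (simp add: fps_to_fls_power)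
  then have "1 / (1 - fls_X) ^ card A = fps_to_fls (hilbert_fps A)"
    by (metis mult.commute divide_eq_eq mult_zero_left zero_neq_one mult_zero_right)
  then have "(fls_X powi k / (1 - fls_X) ^ card A :: rat fls) = fls_X_intpow k * fps_to_fls (hilbert_fps A)"
    by (simp add: divide_inverse)
  then show ?thesis
    by (simp add: fls_X_intpow_times_conv_shift hilbert_fps_def)
qed

section \<open>Graphic arrangements\<close>

text \<open>Orienting by \<open>Max\<close> and \<open>Min\<close> makes the form a function of the
  edge as a set, so that products over edge sets make sense; the price is a sign in later
  comparisons.\<close>

definition edge_form :: "nat set \<Rightarrow> ('k::field) mpoly" where
  "edge_form e = Var (Max e) - Var (Min e)"

definition edge_prod :: "nat set set \<Rightarrow> ('k::field) mpoly" where
  "edge_prod E = (\<Prod>e\<in>E. edge_form e)"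

definition edge_hyperplane :: "nat \<Rightarrow> nat set \<Rightarrow> (nat \<Rightarrow> 'k::field) set" where
  "edge_hyperplane l e = {x \<in> coord_space l. \<forall>u\<in>e. \<forall>v\<in>e. x u = x v}"

lemma edge_form_cases:
  "edge_form {u, v} = Var u - Var v \<or> edge_form {u, v} = Var v - Var u"
  by (cases u v rule: linorder_cases) (auto simp: edge_form_def)

lemma edge_form_dvd_iff [simp]:
  fixes p :: "('k::field) mpoly"
  shows "edge_form {u, v} dvd p \<longleftrightarrow> Var u - Var v dvd p"
proof -
  have "Var v - Var u dvd p \<longleftrightarrow> Var u - Var v dvd p"
    using minus_dvd_iff[of "Var u - Var v" p] unfolding minus_diff_eq .
  then show ?thesis using edge_form_cases[of u v, where 'a='k] by metis
qed

lemma subst_edge_form_eq_0_iff: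
  fixes f :: "nat \<Rightarrow> ('k::field) mpoly"
  shows "subst f (edge_form {u, v}) = 0 \<longleftrightarrow> f u = f v"
proof (rule disjE[OF edge_form_cases[of u v, where 'a='k]])
  assume *: "edge_form {u, v} = (Var v - Var u :: 'k mpoly)"
  show ?thesis unfolding * subst_diff subst_Var right_minus_eq by (rule eq_commute)
qed simp

lemma edge_form_nonzero: "u \<noteq> v \<Longrightarrow> edge_form {u, v} \<noteq> 0"
  using subst_edge_form_eq_0_iff[of Var u v] by simp

locale simple_graph =
  fixes l :: nat and E :: "nat set set"
  assumes edges: "E \<subseteq> [{1..l}]\<^bsup>2\<^esup>"
begin

lemma edgeE:
  assumes "e \<in> E"
  obtains u v where "e = {u, v}" "u \<noteq> v" "u \<in> {1..l}" "v \<in> {1..l}"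
proof -
  have "e \<in> [{1..l}]\<^bsup>2\<^esup>" using assms edges by blast
  then obtain u v where "u \<in> {1..l}" "v \<in> {1..l} - {u}" "e = {u, v}"
    unfolding nsets_2_eq by blast
  then show thesis using that[of u v] by blast
qed

lemma edgeD:
  assumes "{u, v} \<in> E"
  shows "u \<noteq> v" "u \<in> {1..l}" "v \<in> {1..l}"
proof -
  have "{u, v} \<in> [{1..l}]\<^bsup>2\<^esup>" using assms edges by blast
  then show "u \<noteq> v" "u \<in> {1..l}" "v \<in> {1..l}" unfolding doubleton_in_nsets_2 by blast+
qed

lemma finite_edges [simp]: "finite E"
  using edges finite_imp_finite_nsets[of "{1..l}" 2] finite_subset by blast

lemma edge_form_poly_ring: "e \<in> E \<Longrightarrow> edge_form e \<in> poly_ring l"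
proof (elim edgeE)
  fix u v assume "e = {u, v}" "u \<in> {1..l}" "v \<in> {1..l}"
  then show ?thesis
    using disjE[OF edge_form_cases[of u v, where 'a='a]] poly_ring_diff[OF poly_ring_Var poly_ring_Var]
    by metis
qed

lemma edge_form_neq_0: "e \<in> E \<Longrightarrow> edge_form e \<noteq> 0"
  by (elim edgeE) (simp add: edge_form_nonzero)

lemma edge_prod_neq_0 [simp]: "T \<subseteq> E \<Longrightarrow> edge_prod T \<noteq> 0"
  unfolding edge_prod_def using finite_subset[OF _ finite_edges]
  by (auto simp: edge_form_neq_0 subset_iff)

lemma edge_prod_poly_ring: "T \<subseteq> E \<Longrightarrow> edge_prod T \<in> poly_ring l"
  unfolding edge_prod_def by (intro poly_ring_prod edge_form_poly_ring) auto

lemma graphic_arrangement_eq: "graphic_arrangement l E = edge_hyperplane l ` E"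
proof -
  have *: "edge_hyperplane l {u, v} = {x \<in> coord_space l. x u = x v}" for u v
    by (auto simp: edge_hyperplane_def)
  have "graphic_arrangement l E = {edge_hyperplane l {u, v} | u v. {u, v} \<in> E}"
    by (simp only: graphic_arrangement_def *)
  also have "\<dots> = edge_hyperplane l ` E"
    by (blast elim: edgeE)
  finally show ?thesis .
qed

text \<open>The standard basis vectors off the hyperplane of an edge are those indexed by its ends,
  so the hyperplane determines the edge. Hence products over the arrangement can be reindexed by
  \<open>E\<close>.\<close>

lemma edge_hyperplane_inj: "inj_on (edge_hyperplane l :: _ \<Rightarrow> (nat \<Rightarrow> 'k::field) set) E"
proof -
  let ?pt = "\<lambda>i. restrict (\<lambda>j. if j = i then 1 else 0 :: 'k) {1..l}"
  have *: "{i \<in> {1..l}. ?pt i \<notin> edge_hyperplane l e} = e" if e: "e \<in> E" for e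
    using e by (elim edgeE) (auto simp: edge_hyperplane_def coord_space_def)
  show ?thesis
  proof (rule inj_onI)
    fix e e' assume "e \<in> E" "e' \<in> E" "edge_hyperplane l e = (edge_hyperplane l e' :: (nat \<Rightarrow> 'k) set)"
    then show "e = e'" using *[of e] *[of e'] by simp
  qed
qed

end

section \<open>Defining forms of the edge hyperplanes\<close>

lemma defining_form_edge:
  fixes c :: "nat \<Rightarrow> 'k::field"
  assumes "is_defining_form l c (edge_hyperplane l {u, v})"
    and uv: "u \<noteq> v" "u \<in> {1..l}" "v \<in> {1..l}"
  shows "c u \<noteq> 0" "c v = - c u" "\<And>i. i \<in> {1..l} \<Longrightarrow> i \<noteq> u \<Longrightarrow> i \<noteq> v \<Longrightarrow> c i = 0"
proof -
  \<comment> \<open>Indicator vectors serve as test points: that of \<open>A\<close> lies on the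
    hyperplane iff \<open>A\<close> contains both ends or neither. The sets \<open>{i}\<close> and
    \<open>{u, v}\<close> determine \<open>c\<close> up to scaling.\<close>
  let ?pt = "\<lambda>A. restrict (\<lambda>j. if j \<in> A then 1 else 0 :: 'k) {1..l}"
  have H: "edge_hyperplane l {u, v} = {x \<in> coord_space l. (\<Sum>i=1..l. c i * x i) = 0}"
    and nz: "\<exists>i\<in>{1..l}. c i \<noteq> 0"
    using assms(1) by (auto simp: is_defining_form_def)
  have "(\<Sum>i=1..l. c i * ?pt A i) = (\<Sum>i\<in>{1..l} \<inter> A. c i)" for A
    by (subst sum.inter_restrict) (auto intro!: sum.cong)
  moreover have "?pt A \<in> coord_space l" for A
    unfolding coord_space_def by (auto simp: PiE_def)
  ultimately have eq: "?pt A \<in> edge_hyperplane l {u, v} \<longleftrightarrow> (\<Sum>i\<in>{1..l} \<inter> A. c i) = 0" for A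
    unfolding H mem_Collect_eq by presburger
  have mem: "?pt A \<in> edge_hyperplane l {u, v} \<longleftrightarrow> (u \<in> A \<longleftrightarrow> v \<in> A)" for A
    using uv by (auto simp: edge_hyperplane_def coord_space_def)
  show zero: "c i = 0" if "i \<in> {1..l}" "i \<noteq> u" "i \<noteq> v" for i
    using eq[of "{i}"] mem[of "{i}"] that by simp
  have "{1..l} \<inter> {u, v} = {u, v}" using uv by auto
  then have "c u + c v = 0"
    using eq[of "{u, v}"] mem[of "{u, v}"] uv by simp
  then show "c v = - c u" by (simp add: add_eq_0_iff)
  then show "c u \<noteq> 0" using nz zero by force
qed

lemma linear_poly_edge:
  assumes "c v = - c u" "\<And>i. i \<in> {1..l} \<Longrightarrow> i \<noteq> u \<Longrightarrow> i \<noteq> v \<Longrightarrow> c i = 0"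
    and uv: "u \<noteq> v" "u \<in> {1..l}" "v \<in> {1..l}"
  shows "linear_poly l c = single 0 (c u) * (Var u - Var v)"
proof -
  have "linear_poly l c = (\<Sum>i\<in>{1..l}. single 0 (c i) * Var i)"
    by (simp add: linear_poly_def Var_def mult_single)
  also have "\<dots> = (\<Sum>i\<in>{u, v}. single 0 (c i) * Var i)"
    by (rule sum.mono_neutral_right) (use assms in auto)
  also have "\<dots> = single 0 (c u) * (Var u - Var v)"
    using assms by (simp add: single_uminus algebra_simps)
  finally show ?thesis .
qed

text \<open>The wedge of \<open>\<eta>\<close> with d(x_u - x_v) has, up to sign, the coefficient
  \<open>\<eta> u + \<eta> v\<close> at the pair u, v, the coefficient \<open>\<eta> i\<close> at a
  pair of \<open>i\<close> and one end, and 0 at all other pairs. So these are the numerators of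
  logarithmic forms over \<open>edge_prod E\<close>.\<close>

definition log_numerators :: "nat \<Rightarrow> nat set set \<Rightarrow> (nat \<Rightarrow> ('k::field) mpoly) set" where
  "log_numerators l E = {\<eta>. (\<forall>i\<in>{1..l}. \<eta> i \<in> poly_ring l) \<and> (\<forall>i. i \<notin> {1..l} \<longrightarrow> \<eta> i = 0) \<and>
     (\<forall>u v. {u, v} \<in> E \<longrightarrow> Var u - Var v dvd \<eta> u + \<eta> v \<and>
        (\<forall>i. i \<noteq> u \<longrightarrow> i \<noteq> v \<longrightarrow> Var u - Var v dvd \<eta> i))}"

lemma single_eq_0_iff [simp]: "single k c = 0 \<longleftrightarrow> c = 0"
  by (metis lookup_single_eq lookup_zero single_zero)

lemma const_dvd_cancel:
  fixes p q :: "('k::field) mpoly"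
  assumes "c \<noteq> 0" "p dvd single 0 c * q"
  shows "p dvd q"
proof -
  have "p dvd single 0 (inverse c) * (single 0 c * q)"
    using assms(2) by (rule dvd_mult)
  also have "single 0 (inverse c) * (single 0 c * q) = q"
    using assms(1) by (simp add: mult_single single_one flip: mult.assoc)
  finally show ?thesis .
qed

context simple_graph
begin

text \<open>Every \<open>\<alpha> H\<close> is a nonzero multiple of an edge form, so
  \<open>Q\<close> is a nonzero constant times \<open>edge_prod E\<close>, and the constant moves
  into the numerators. From here on the choice of \<open>\<alpha>\<close> has disappeared.\<close>

lemma log_forms_eq:
  fixes \<alpha> :: "(nat \<Rightarrow> 'k::field) set \<Rightarrow> nat \<Rightarrow> 'k"
  assumes \<alpha>: "\<And>H. H \<in> graphic_arrangement l E \<Longrightarrow> is_defining_form l (\<alpha> H) H"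
  shows "log_forms l \<alpha> (graphic_arrangement l E) =
    (\<lambda>\<eta> i. to_fract (\<eta> i) / to_fract (edge_prod E)) ` log_numerators l E"
proof -
  let ?H = "edge_hyperplane l :: _ \<Rightarrow> (nat \<Rightarrow> 'k) set"
  let ?D = "edge_prod E :: 'k mpoly"
  have df: "\<alpha> (?H {u, v}) u \<noteq> 0" "\<alpha> (?H {u, v}) v = - \<alpha> (?H {u, v}) u"
    "\<And>i. i \<in> {1..l} \<Longrightarrow> i \<noteq> u \<Longrightarrow> i \<noteq> v \<Longrightarrow> \<alpha> (?H {u, v}) i = 0"
    if uv: "{u, v} \<in> E" for u v
  proof -
    have "is_defining_form l (\<alpha> (?H {u, v})) (?H {u, v})"
      using \<alpha> uv unfolding graphic_arrangement_eq by blast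
    note defining_form_edge[OF this edgeD[OF uv]]
    then show "\<alpha> (?H {u, v}) u \<noteq> 0" "\<alpha> (?H {u, v}) v = - \<alpha> (?H {u, v}) u"
      "\<And>i. i \<in> {1..l} \<Longrightarrow> i \<noteq> u \<Longrightarrow> i \<noteq> v \<Longrightarrow> \<alpha> (?H {u, v}) i = 0"
      by blast+
  qed
  have lp: "linear_poly l (\<alpha> (?H {u, v})) = single 0 (\<alpha> (?H {u, v}) u) * (Var u - Var v)"
    if "{u, v} \<in> E" for u v
    by (rule linear_poly_edge[of "\<alpha> (?H {u, v})", OF df(2)[OF that] df(3)[OF that] edgeD[OF that]])
  \<comment> \<open>The scalar \<open>a\<close> also absorbs the sign between
    \<open>Var u - Var v\<close> and \<open>edge_form {u, v}\<close>.\<close>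
  have "\<exists>a. a \<noteq> 0 \<and> linear_poly l (\<alpha> (?H e)) = single 0 a * edge_form e" if eE: "e \<in> E" for e
  proof -
    obtain u v where e: "e = {u, v}" using eE by (rule edgeE)
    have "single 0 (- a) * (Var u - Var v) = single 0 a * (Var v - Var u :: 'k mpoly)" for a
      by (simp add: single_uminus algebra_simps)
    then show ?thesis using lp[of u v] df(1)[of u v] eE edge_form_cases[of u v, where 'a='k] unfolding e
      by (metis neg_equal_0_iff_equal minus_minus)
  qed
  then obtain a where a: "\<And>e. e \<in> E \<Longrightarrow> a e \<noteq> 0"
    "\<And>e. e \<in> E \<Longrightarrow> linear_poly l (\<alpha> (?H e)) = single 0 (a e) * edge_form e"
    by metis
  define c where "c = prod a E"
  have c: "c \<noteq> 0" using a(1) by (simp add: c_def)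
  have c_single: "(\<Prod>e\<in>T. single 0 (a e)) = (single 0 (prod a T) :: 'k mpoly)" for T
    by (induction T rule: infinite_finite_induct) (simp_all add: single_one mult_single)
  define Q where "Q = defining_poly l \<alpha> (graphic_arrangement l E)"
  have Q: "Q = single 0 c * ?D"
    unfolding Q_def defining_poly_def graphic_arrangement_eq prod.reindex[OF edge_hyperplane_inj]
    using a(2) by (simp add: edge_prod_def prod.distrib c_single c_def)
  have Q0: "Q \<noteq> 0"
    using c by (simp add: Q)
  have Qc: "to_fract (single 0 c * p) / to_fract Q = to_fract p / to_fract ?D" for p
    using c by (simp add: Q)
  show ?thesis
  proof (intro equalityI subsetI)
    fix \<omega> assume \<omega>: "\<omega> \<in> log_forms l \<alpha> (graphic_arrangement l E)"
    then obtain \<omega>0 where \<omega>0: "\<omega>0 \<in> Omega1 l" "\<omega> = form_mult (1 / to_fract Q) \<omega>0"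
      by (auto simp: log_forms_def Q_def)
    have "\<exists>p. \<omega>0 i = to_fract p \<and> p \<in> poly_ring l \<and> (i \<notin> {1..l} \<longrightarrow> p = 0)" for i
    proof (cases "i \<in> {1..l}")
      case True
      then show ?thesis using \<omega>0(1) unfolding Omega1_def by blast
    next
      case False
      then have "\<omega>0 i = to_fract 0" using \<omega>0(1) unfolding Omega1_def by simp
      then show ?thesis using poly_ring_0 by blast
    qed
    then obtain p where p: "\<And>i. \<omega>0 i = to_fract (p i)" "\<And>i. p i \<in> poly_ring l"
      "\<And>i. i \<notin> {1..l} \<Longrightarrow> p i = 0"
      by metis
    have Q\<omega>: "form_mult (to_fract Q) \<omega> = \<omega>0"
      using Q0 by (simp add: \<omega>0(2) form_mult_def)
    have dvd: "Var u - Var v dvd p i * single 0 (\<alpha> (?H {u, v}) j) - p j * single 0 (\<alpha> (?H {u, v}) i)"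
      if uv: "{u, v} \<in> E" and ij: "i \<in> {1..l}" "j \<in> {1..l}" "i < j" for u v i j
    proof -
      have "wedge \<omega>0 (d_linear l (\<alpha> (?H {u, v})))
          \<in> form_mult (to_fract (linear_poly l (\<alpha> (?H {u, v})))) ` Omega2 l"
        using \<omega> uv unfolding log_forms_def Q\<omega>[unfolded Q_def, symmetric] graphic_arrangement_eq
        by blast
      then obtain \<theta> where \<theta>: "\<theta> \<in> Omega2 l"
        "wedge \<omega>0 (d_linear l (\<alpha> (?H {u, v}))) = form_mult (to_fract (linear_poly l (\<alpha> (?H {u, v})))) \<theta>"
        by blast
      have "if 1 \<le> i \<and> i < j \<and> j \<le> l then \<theta> (i, j) \<in> to_fract ` poly_ring l else \<theta> (i, j) = 0"
        using \<theta>(1) unfolding Omega2_def by blast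
      then obtain r where r: "\<theta> (i, j) = to_fract r"
        using ij by auto
      have "to_fract (p i * single 0 (\<alpha> (?H {u, v}) j) - p j * single 0 (\<alpha> (?H {u, v}) i))
          = to_fract (linear_poly l (\<alpha> (?H {u, v})) * r)"
        using fun_cong[OF \<theta>(2), of "(i, j)"] ij
        by (simp add: wedge_def d_linear_def form_mult_def p r const_def)
      then have "p i * single 0 (\<alpha> (?H {u, v}) j) - p j * single 0 (\<alpha> (?H {u, v}) i)
          = (Var u - Var v) * (single 0 (\<alpha> (?H {u, v}) u) * r)"
        unfolding to_fract_eq_iff lp[OF uv] by (simp add: mult_ac)
      then show ?thesis by simp
    qed
    \<comment> \<open>Pairing \<open>i\<close> with the end \<open>u\<close> isolates
      \<open>p i\<close>, because the defining form is zero at \<open>i\<close>; the order of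
      \<open>i\<close> and \<open>u\<close> decides which wedge coefficient is stored.\<close>
    have dvd1: "Var u - Var v dvd p i" if uv: "{u, v} \<in> E" "i \<noteq> u" "i \<noteq> v" for u v i
    proof (cases "i \<in> {1..l}")
      case True
      note e = edgeD[OF uv(1)] and d = df[OF uv(1)]
      have "Var u - Var v dvd single 0 (\<alpha> (?H {u, v}) u) * p i"
      proof (cases i u rule: linorder_cases)
        case less
        then show ?thesis using dvd[OF uv(1) True e(2) less] d(3)[OF True uv(2,3)] by (simp add: mult.commute)
      next
        case greater
        then show ?thesis using dvd[OF uv(1) e(2) True greater] d(3)[OF True uv(2,3)] by (simp add: mult.commute)
      qed (use uv in simp)
      then show ?thesis by (rule const_dvd_cancel[OF d(1)])
    qed (simp add: p)
    have dvd2: "Var u - Var v dvd p u + p v" if uv: "{u, v} \<in> E" for u v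
    proof -
      note e = edgeD[OF uv] and d = df[OF uv]
      have "Var u - Var v dvd single 0 (\<alpha> (?H {u, v}) u) * (p u + p v)"
      proof (cases u v rule: linorder_cases)
        case less
        have "Var u - Var v dvd - (single 0 (\<alpha> (?H {u, v}) u) * (p u + p v))"
          using dvd[OF uv e(2,3) less] d(2) by (simp add: single_uminus algebra_simps)
        then show ?thesis by simp
      next
        case greater
        then show ?thesis
          using dvd[OF uv e(3,2) greater] d(2) by (simp add: single_uminus algebra_simps)
      qed (use e in simp)
      then show ?thesis by (rule const_dvd_cancel[OF d(1)])
    qed
    \<comment> \<open>Dividing by \<open>c\<close> compensates for
      \<open>Q = c * edge_prod E\<close>.\<close>
    define \<eta> where "\<eta> = (\<lambda>i. single 0 (inverse c) * p i)"
    have "\<eta> \<in> log_numerators l E"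
      using p(2,3) dvd1 dvd2 unfolding log_numerators_def \<eta>_def
      by (auto intro!: poly_ring_mult simp flip: distrib_left)
    moreover have "\<omega> i = to_fract (\<eta> i) / to_fract ?D" for i
    proof -
      have "single 0 c * \<eta> i = p i"
        using c by (simp add: \<eta>_def mult_single single_one flip: mult.assoc)
      then show ?thesis
        using Qc[of "\<eta> i"] by (simp add: \<omega>0(2) form_mult_def p)
    qed
    ultimately show "\<omega> \<in> (\<lambda>\<eta> i. to_fract (\<eta> i) / to_fract ?D) ` log_numerators l E"
      by (auto simp: fun_eq_iff)
  next
    fix \<omega> assume "\<omega> \<in> (\<lambda>\<eta> i. to_fract (\<eta> i) / to_fract ?D) ` log_numerators l E"
    then obtain \<eta> where \<eta>: "\<eta> \<in> log_numerators l E" "\<omega> = (\<lambda>i. to_fract (\<eta> i) / to_fract ?D)"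
      by blast
    define p where "p = (\<lambda>i. single 0 c * \<eta> i)"
    have p: "p i \<in> poly_ring l" for i
      using \<eta>(1) poly_ring_0[of l] unfolding p_def log_numerators_def
      by (cases "i \<in> {1..l}") (auto intro!: poly_ring_mult)
    have p0: "i \<notin> {1..l} \<Longrightarrow> p i = 0" for i
      using \<eta>(1) unfolding p_def log_numerators_def by auto
    define \<omega>0 where "\<omega>0 = (\<lambda>i. to_fract (p i))"
    have \<omega>0: "\<omega>0 \<in> Omega1 l"
      using p p0 by (auto simp: Omega1_def \<omega>0_def)
    have \<omega>: "\<omega> = form_mult (1 / to_fract Q) \<omega>0"
      using Qc by (simp add: \<eta>(2) form_mult_def \<omega>0_def p_def fun_eq_iff del: to_fract_mult)
    have Q\<omega>: "form_mult (to_fract Q) \<omega> = \<omega>0"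
      using Q0 by (simp add: \<omega> form_mult_def)
    have "wedge \<omega>0 (d_linear l (\<alpha> H)) \<in> form_mult (to_fract (linear_poly l (\<alpha> H))) ` Omega2 l"
      if H_in: "H \<in> graphic_arrangement l E" for H
    proof -
      obtain e where "e \<in> E" "H = ?H e" using H_in unfolding graphic_arrangement_eq by blast
      then obtain u v where uv: "{u, v} \<in> E" and H: "H = ?H {u, v}" by (metis edgeE)
      note e = edgeD[OF uv] and d = df[OF uv, folded H]
      let ?a = "\<alpha> H u"
      have lpH: "linear_poly l (\<alpha> H) = single 0 ?a * (Var u - Var v)"
        using lp[OF uv] by (simp add: H)
      have lp_ring: "linear_poly l (\<alpha> H) \<in> poly_ring l" "linear_poly l (\<alpha> H) \<noteq> 0"
        unfolding lpH using e d(1) by (auto intro!: poly_ring_mult poly_ring_diff poly_ring_Var)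
      have dvd1: "Var u - Var v dvd p i" if "i \<noteq> u" "i \<noteq> v" for i
        using \<eta>(1) uv that unfolding log_numerators_def p_def by auto
      have "Var u - Var v dvd single 0 c * (\<eta> u + \<eta> v)"
        using \<eta>(1) uv unfolding log_numerators_def by auto
      then have dvd2: "Var u - Var v dvd p u + p v"
        by (simp add: p_def distrib_left)
      define w where "w = (\<lambda>i j. p i * single 0 (\<alpha> H j) - p j * single 0 (\<alpha> H i))"
      have dvd: "Var u - Var v dvd w i j" if "i \<in> {1..l}" "j \<in> {1..l}" for i j
      proof -
        consider "i = u" "j = u" | "i = u" "j = v" | "i = u" "j \<notin> {u, v}"
          | "i = v" "j = v" | "i = v" "j = u" | "i = v" "j \<notin> {u, v}"
          | "i \<notin> {u, v}" "j \<in> {u, v}" | "i \<notin> {u, v}" "j \<notin> {u, v}" by blast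
        then show ?thesis
        proof cases
          case 2
          have "w i j = - (single 0 ?a * (p u + p v))"
            using 2 d(2) by (simp add: w_def single_uminus algebra_simps)
          then show ?thesis using dvd2 by simp
        next
          case 5
          have "w i j = single 0 ?a * (p u + p v)"
            using 5 d(2) by (simp add: w_def single_uminus algebra_simps)
          then show ?thesis using dvd2 by simp
        qed (use dvd1 d(3) that in \<open>auto simp: w_def\<close>)
      qed
      \<comment> \<open>So far the divisibility holds in the ambient ring; that the quotient lies in
        S, as \<open>Omega2\<close> demands, follows by cancellation.\<close>
      have "\<exists>r. r \<in> poly_ring l \<and> w i j = linear_poly l (\<alpha> H) * r"
        if ij: "i \<in> {1..l}" "j \<in> {1..l}" for i j
      proof -
        obtain r where r: "w i j = (Var u - Var v) * r" using dvd[OF ij] ..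
        have "linear_poly l (\<alpha> H) * (single 0 (inverse ?a) * r)
            = (single 0 ?a * single 0 (inverse ?a)) * ((Var u - Var v) * r)"
          unfolding lpH by (simp only: mult_ac)
        also have "single 0 ?a * single 0 (inverse ?a) = (1 :: 'k mpoly)"
          using d(1) by (simp add: mult_single single_one)
        finally have eq: "w i j = linear_poly l (\<alpha> H) * (single 0 (inverse ?a) * r)"
          unfolding r by (simp only: mult_1_left)
        have "w i j \<in> poly_ring l"
          unfolding w_def by (intro poly_ring_diff poly_ring_mult p poly_ring_const)
        then have "single 0 (inverse ?a) * r \<in> poly_ring l"
          unfolding eq using lp_ring by (rule poly_ring_cancel)
        then show ?thesis using eq by blast
      qed
      then obtain r where r: "\<And>i j. i \<in> {1..l} \<Longrightarrow> j \<in> {1..l} \<Longrightarrow> r i j \<in> poly_ring l"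
        "\<And>i j. i \<in> {1..l} \<Longrightarrow> j \<in> {1..l} \<Longrightarrow> w i j = linear_poly l (\<alpha> H) * r i j"
        by metis
      define \<theta> where "\<theta> = (\<lambda>(i, j). if 1 \<le> i \<and> i < j \<and> j \<le> l then to_fract (r i j) else 0)"
      have "\<theta> \<in> Omega2 l"
        using r(1) by (auto simp: Omega2_def \<theta>_def)
      moreover have "wedge \<omega>0 (d_linear l (\<alpha> H)) = form_mult (to_fract (linear_poly l (\<alpha> H))) \<theta>"
      proof (rule ext, clarify)
        fix i j
        show "wedge \<omega>0 (d_linear l (\<alpha> H)) (i, j) = form_mult (to_fract (linear_poly l (\<alpha> H))) \<theta> (i, j)"
        proof (cases "1 \<le> i \<and> i < j \<and> j \<le> l")
          case True
          then have "wedge \<omega>0 (d_linear l (\<alpha> H)) (i, j) = to_fract (w i j)"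
            by (auto simp: wedge_def d_linear_def \<omega>0_def const_def w_def)
          also have "\<dots> = form_mult (to_fract (linear_poly l (\<alpha> H))) \<theta> (i, j)"
            using True r(2)[of i j] by (simp add: form_mult_def \<theta>_def)
          finally show ?thesis .
        next
          case False
          then show ?thesis
            using p0 by (auto simp: wedge_def d_linear_def \<omega>0_def form_mult_def \<theta>_def)
        qed
      qed
      ultimately show ?thesis by blast
    qed
    then show "\<omega> \<in> log_forms l \<alpha> (graphic_arrangement l E)"
      unfolding log_forms_def Q_def[symmetric] using \<omega> \<omega>0 Q\<omega> by auto
  qed
qed

end

section \<open>Numerators of logarithmic forms\<close>

definition vertex_prod :: "nat \<Rightarrow> nat set \<Rightarrow> ('k::field) mpoly" where
  "vertex_prod v A = (\<Prod>j\<in>A. Var v - Var j)"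

text \<open>With this sign the coordinate change is its own inverse, and it turns monomials in the
  variables other than x_v into products of differences \<open>Var v - Var j\<close>.\<close>

definition shift :: "nat \<Rightarrow> nat \<Rightarrow> ('k::field) mpoly" where
  "shift v i = (if i = v then Var v else Var v - Var i)"

lemma subst_shift_shift [simp]:
  fixes p :: "('k::field) mpoly"
  shows "subst (shift v) (subst (shift v) p) = p"
proof -
  have "(\<lambda>i. subst (shift v) (shift v i)) = (Var :: nat \<Rightarrow> 'k mpoly)"
    by (auto simp: shift_def)
  then show ?thesis by (simp add: subst_subst)
qed

lemma subst_shift_eq_0_iff [simp]: "subst (shift v) p = 0 \<longleftrightarrow> p = 0"
  by (metis subst_0 subst_shift_shift)

lemma subst_shift_poly_ring: "v \<in> {1..l} \<Longrightarrow> p \<in> poly_ring l \<Longrightarrow> subst (shift v) p \<in> poly_ring l"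
  by (rule poly_ring_subst) (auto simp: shift_def intro!: poly_ring_diff poly_ring_Var)

lemma homogeneous_shift: "homogeneous n p \<Longrightarrow> homogeneous n (subst (shift v) p)"
  using homogeneous_Var
  by (intro homogeneous_subst) (auto simp: shift_def intro!: homogeneous_diff)

lemma vertex_prod_neq_0: "v \<notin> A \<Longrightarrow> vertex_prod v A \<noteq> 0"
  by (cases "finite A") (auto simp: vertex_prod_def)

lemma homogeneous_vertex_prod: "homogeneous (card A) (vertex_prod v A :: ('k::field) mpoly)"
proof -
  have "homogeneous 1 (Var v - Var j :: 'k mpoly)" for j
    by (rule homogeneous_diff[OF homogeneous_Var homogeneous_Var])
  then show ?thesis
    using homogeneous_prod[of A "\<lambda>_. 1" "\<lambda>j. Var v - Var j :: 'k mpoly"]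
    by (simp add: vertex_prod_def)
qed

section \<open>Products over stars and coprimality of edge forms\<close>

lemma inj_on_star: "v \<notin> A \<Longrightarrow> inj_on (\<lambda>j. {v, j}) A"
  by (auto simp: inj_on_def doubleton_eq_iff)

text \<open>\<open>c\<close> is the product of the orientation signs; recording it by
  \<open>c * c = 1\<close> lets it cross an equation without division.\<close>

lemma edge_prod_star:
  assumes "v \<notin> A"
  shows "\<exists>c. c * c = 1 \<and> edge_prod ((\<lambda>j. {v, j}) ` A) = c * (vertex_prod v A :: ('k::field) mpoly)"
proof -
  have "\<exists>c. c * c = 1 \<and> edge_form {v, j} = c * (Var v - Var j :: 'k mpoly)" for j
    using edge_form_cases[of v j, where 'a='k]
    by (elim disjE) (auto intro: exI[of _ 1] exI[of _ "-1"])
  then obtain c where c: "\<And>j. c j * c j = 1" "\<And>j. edge_form {v, j} = c j * (Var v - Var j :: 'k mpoly)"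
    by metis
  have "edge_prod ((\<lambda>j. {v, j}) ` A) = prod c A * (vertex_prod v A :: 'k mpoly)"
    unfolding edge_prod_def prod.reindex[OF inj_on_star[OF assms]]
    by (simp add: c(2) vertex_prod_def prod.distrib)
  moreover have "prod c A * prod c A = 1"
    by (simp add: c(1) flip: prod.distrib)
  ultimately show ?thesis by blast
qed

lemma vertex_prod_dvd_edge_prod:
  assumes "v \<notin> A"
  shows "vertex_prod v A dvd edge_prod ((\<lambda>j. {v, j}) ` A)"
  using edge_prod_star[OF assms] by (metis dvd_triv_right)

lemma edge_prod_Un:
  "finite S \<Longrightarrow> finite T \<Longrightarrow> S \<inter> T = {} \<Longrightarrow> edge_prod (S \<union> T) = edge_prod S * edge_prod T"
  unfolding edge_prod_def by (rule prod.union_disjoint)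

lemma edge_prod_mono: "finite T \<Longrightarrow> S \<subseteq> T \<Longrightarrow> edge_prod S dvd edge_prod T"
  unfolding edge_prod_def by (rule prod_dvd_prod_subset)

lemma subst_merge_edge_form_eq_0_iff:
  assumes "a \<noteq> b" "u \<noteq> v"
  shows "subst (Var(u := Var v)) (edge_form {a, b}) = (0 :: ('k::field) mpoly) \<longleftrightarrow> {a, b} = {u, v}"
  unfolding subst_edge_form_eq_0_iff using assms by (auto simp: doubleton_eq_iff)

context simple_graph
begin

text \<open>Merging \<open>u\<close> into \<open>v\<close> kills no edge form but that of
  \<open>{u, v}\<close>, and the ring is a domain. Thus distinct edge forms can be treated as
  coprime.\<close>

lemma subst_merge_edge_prod_neq_0:
  assumes "T \<subseteq> E" "{u, v} \<in> E" "{u, v} \<notin> T"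
  shows "subst (Var(u := Var v)) (edge_prod T) \<noteq> (0 :: ('k::field) mpoly)"
proof -
  have "subst (Var(u := Var v)) (edge_form e) \<noteq> (0 :: 'k mpoly)" if e: "e \<in> T" for e
  proof -
    obtain a b where ab: "e = {a, b}" "a \<noteq> b" using e assms(1) by (metis edgeE subsetD)
    then show ?thesis
      using subst_merge_edge_form_eq_0_iff[OF ab(2) edgeD(1)[OF assms(2)], where 'k='k] assms(3) e by metis
  qed
  then show ?thesis
    using finite_subset[OF assms(1) finite_edges] by (simp add: edge_prod_def)
qed

text \<open>Once \<open>edge_prod T\<close> is split off, the next edge form divides
  \<open>edge_prod T * r\<close>; as the first factor does not vanish on its hyperplane, it divides
  \<open>r\<close>.\<close>

lemma edge_prod_dvd:
  fixes f :: "('k::field) mpoly"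
  assumes "T \<subseteq> E" "\<And>e. e \<in> T \<Longrightarrow> edge_form e dvd f"
  shows "edge_prod T dvd f"
proof -
  have "finite T" using assms(1) finite_edges finite_subset by blast
  then show ?thesis using assms
  proof (induction T rule: finite_induct)
    case (insert e T)
    obtain u v where uv: "e = {u, v}" using insert.prems(1) by (metis edgeE insert_subset)
    obtain r where r: "f = edge_prod T * r" using insert by auto
    have "{u, v} \<in> E" "{u, v} \<notin> T" "T \<subseteq> E" using insert uv by auto
    then have "subst (Var(u := Var v)) (edge_prod T) \<noteq> (0 :: 'k mpoly)"
      by (intro subst_merge_edge_prod_neq_0)
    moreover have "edge_form e dvd f" using insert.prems(2) by simp
    then have "Var u - Var v dvd edge_prod T * r" unfolding uv r by simp
    ultimately have "Var u - Var v dvd r" by (simp add: Var_diff_dvd_iff)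
    then have "edge_form e dvd r" by (simp add: uv)
    then have "edge_form e * edge_prod T dvd r * edge_prod T" by (rule mult_dvd_mono) simp
    then show ?case using insert by (simp add: edge_prod_def r mult.commute)
  qed (simp add: edge_prod_def)
qed

section \<open>The module of numerators and its elements attached to cliques\<close>

lemma log_numerators_add:
  assumes \<eta>: "\<eta> \<in> log_numerators l E" and \<zeta>: "\<zeta> \<in> log_numerators l E"
  shows "(\<lambda>i. \<eta> i + \<zeta> i) \<in> log_numerators l E"
  unfolding log_numerators_def
proof (intro CollectI conjI ballI allI impI)
  fix u v assume uv: "{u, v} \<in> E"
  then have "Var u - Var v dvd \<eta> u + \<eta> v" "Var u - Var v dvd \<zeta> u + \<zeta> v"
    using \<eta> \<zeta> unfolding log_numerators_def by blast+
  then have "Var u - Var v dvd (\<eta> u + \<eta> v) + (\<zeta> u + \<zeta> v)" by (rule dvd_add)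
  then show "Var u - Var v dvd \<eta> u + \<zeta> u + (\<eta> v + \<zeta> v)" by (simp only: add_ac)
  fix i assume "i \<noteq> u" "i \<noteq> v"
  then show "Var u - Var v dvd \<eta> i + \<zeta> i"
    using \<eta> \<zeta> uv unfolding log_numerators_def by (blast intro: dvd_add)
qed (use \<eta> \<zeta> in \<open>auto simp: log_numerators_def intro: poly_ring_add\<close>)

lemma log_numerators_mult:
  assumes "\<eta> \<in> log_numerators l E" "p \<in> poly_ring l"
  shows "(\<lambda>i. p * \<eta> i) \<in> log_numerators l E"
  using assms unfolding log_numerators_def
  by (auto intro: poly_ring_mult simp flip: distrib_left)

lemma clique_star: "clique F E \<Longrightarrow> i \<in> F \<Longrightarrow> (\<lambda>j. {i, j}) ` (F - {i}) \<subseteq> E"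
  by (auto simp: clique_def)

text \<open>
  In partial fractions, the form constructed here is \<open>\<Sum>\<^bsub>i\<in>F\<^esub> dx\<^sub>i / \<Prod>\<^bsub>j\<in>F-{i}\<^esub> (x\<^sub>i - x\<^sub>j)\<close>: its
  coefficients are the residues of \<open>1 / \<Prod>\<^bsub>j\<in>F\<^esub> (y - x\<^sub>j)\<close> in an additional variable \<open>y\<close>.
\<close>

lemma ex_clique_numerator:
  assumes F: "clique F E" "F \<subseteq> {1..l}"
  shows "\<exists>\<eta>\<in>log_numerators l E. (\<forall>i. i \<notin> F \<longrightarrow> \<eta> i = 0) \<and>
    (\<forall>i\<in>F. edge_prod E = vertex_prod i (F - {i}) * (\<eta> i :: ('k::field) mpoly))"
proof -
  let ?T = "\<lambda>i. (\<lambda>j. {i, j}) ` (F - {i})"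
  have fin: "finite F" using F(2) finite_subset by blast
  have "\<exists>r. edge_prod E = vertex_prod i (F - {i}) * (r :: 'k mpoly)" if "i \<in> F" for i
  proof -
    have "vertex_prod i (F - {i}) dvd (edge_prod (?T i) :: 'k mpoly)"
      by (rule vertex_prod_dvd_edge_prod) simp
    also have "\<dots> dvd edge_prod E"
      by (rule edge_prod_mono[OF finite_edges clique_star[OF F(1) that]])
    finally show ?thesis by (auto simp: dvd_def)
  qed
  then obtain r where r: "\<And>i. i \<in> F \<Longrightarrow> edge_prod E = vertex_prod i (F - {i}) * (r i :: 'k mpoly)"
    by metis
  have vp: "vertex_prod i (F - {i}) \<noteq> (0 :: 'k mpoly)" for i
    by (simp add: vertex_prod_neq_0)
  define \<eta> where "\<eta> = (\<lambda>i. if i \<in> F then r i else 0)"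
  have ring: "\<eta> i \<in> poly_ring l" for i
  proof (cases "i \<in> F")
    case True
    have "vertex_prod i (F - {i}) * r i \<in> poly_ring l"
      unfolding r[OF True, symmetric] by (rule edge_prod_poly_ring) simp
    moreover have "vertex_prod i (F - {i}) \<in> poly_ring l"
      unfolding vertex_prod_def using F(2) True
      by (intro poly_ring_prod poly_ring_diff poly_ring_Var) auto
    ultimately show ?thesis using vp[of i] True by (auto simp: \<eta>_def intro: poly_ring_cancel)
  qed (simp add: \<eta>_def)
  \<comment> \<open>An edge outside the star of \<open>i\<close> in \<open>F\<close> gives a factor
    of \<open>edge_prod E\<close> distinct from those in the denominator at \<open>i\<close>, so it
    survives in \<open>r i\<close>.\<close>
  have other: "Var u - Var v dvd \<eta> i" if uv: "{u, v} \<in> E" "{u, v} \<notin> ?T i" for u v i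
  proof (cases "i \<in> F")
    case True
    have "vertex_prod i (F - {i}) * (edge_form {u, v} :: 'k mpoly) dvd edge_prod (?T i) * edge_form {u, v}"
      by (intro mult_dvd_mono vertex_prod_dvd_edge_prod) auto
    also have "\<dots> = edge_prod (insert {u, v} (?T i))"
      using uv(2) fin by (simp add: edge_prod_def mult.commute)
    also have "\<dots> dvd edge_prod E"
      using uv(1) clique_star[OF F(1) True] by (intro edge_prod_mono) auto
    finally have "edge_form {u, v} dvd r i"
      unfolding r[OF True] using vp[of i] by simp
    then show ?thesis using True by (simp add: \<eta>_def)
  qed (simp add: \<eta>_def)
  have sum: "Var u - Var v dvd \<eta> u + \<eta> v" if uv: "{u, v} \<in> E" for u v
  proof (cases "u \<in> F \<and> v \<in> F")
    case True
    \<comment> \<open>\<open>?\<delta>\<close> enters the two denominators with opposite signs, so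
      the two numerators add up to a multiple of the difference of two products that coincide on x_u
      = x_v.\<close>
    let ?G = "F - {u, v}" and ?\<delta> = "Var u - Var v :: 'k mpoly"
    note ne = edgeD(1)[OF uv]
    have eqs: "F - {u} = insert v ?G" "F - {v} = insert u ?G" using True ne by auto
    have split: "vertex_prod u (F - {u}) = ?\<delta> * vertex_prod u ?G"
      "vertex_prod v (F - {v}) = - ?\<delta> * vertex_prod v ?G"
      unfolding eqs vertex_prod_def using fin by simp_all
    let ?U = "(\<lambda>j. {u, j}) ` ?G" and ?V = "(\<lambda>j. {v, j}) ` ?G"
    have "?\<delta> * (vertex_prod u ?G * vertex_prod v ?G) dvd edge_form {u, v} * (edge_prod ?U * edge_prod ?V)"
    proof (intro mult_dvd_mono vertex_prod_dvd_edge_prod)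
      show "?\<delta> dvd edge_form {u, v}"
        unfolding edge_form_dvd_iff[symmetric] by (rule dvd_refl)
    qed simp_all
    also have "\<dots> = edge_form {u, v} * edge_prod (?U \<union> ?V)"
      using fin ne by (subst edge_prod_Un) (auto simp: doubleton_eq_iff)
    also have "\<dots> = edge_prod (insert {u, v} (?U \<union> ?V))"
      unfolding edge_prod_def using fin ne by (subst prod.insert) (auto simp: doubleton_eq_iff)
    also have "\<dots> dvd edge_prod E"
      using F(1) True uv by (intro edge_prod_mono) (auto simp: clique_def)
    finally obtain s where s: "edge_prod E = ?\<delta> * (vertex_prod u ?G * vertex_prod v ?G) * s" ..
    have nz: "?\<delta> \<noteq> 0" "vertex_prod u ?G \<noteq> (0 :: 'k mpoly)" "vertex_prod v ?G \<noteq> (0 :: 'k mpoly)"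
      using ne by (auto simp: vertex_prod_neq_0)
    have "(?\<delta> * vertex_prod u ?G) * r u = (?\<delta> * vertex_prod u ?G) * (vertex_prod v ?G * s)"
      using s r[of u] True unfolding split by (simp only: mult_ac)
    then have ru: "r u = vertex_prod v ?G * s"
      using nz(1,2) by (subst (asm) mult_left_cancel) (rule no_zero_divisors)
    have "v \<in> F" using True by blast
    then have "(?\<delta> * vertex_prod v ?G) * r v = - edge_prod E"
      unfolding r[OF \<open>v \<in> F\<close>] split by (simp only: mult_minus_left minus_minus)
    also have "\<dots> = (?\<delta> * vertex_prod v ?G) * (- (vertex_prod u ?G * s))"
      unfolding s by (simp only: mult_minus_right mult_ac)
    finally have rv: "r v = - (vertex_prod u ?G * s)"
      using nz(1,3) by (subst (asm) mult_left_cancel) (rule no_zero_divisors)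
    have "\<eta> u + \<eta> v = (vertex_prod v ?G - vertex_prod u ?G) * s"
      using True by (simp add: \<eta>_def ru rv left_diff_distrib)
    moreover have "Var v - Var u dvd vertex_prod v ?G - (vertex_prod u ?G :: 'k mpoly)"
      unfolding vertex_prod_def by (rule dvd_prod_diff) simp
    then have "edge_form {v, u} dvd vertex_prod v ?G - (vertex_prod u ?G :: 'k mpoly)"
      unfolding edge_form_dvd_iff .
    then have "?\<delta> dvd vertex_prod v ?G - vertex_prod u ?G"
      unfolding insert_commute[of v] edge_form_dvd_iff .
    ultimately show ?thesis by (simp only: dvd_mult2)
  next
    case False
    \<comment> \<open>If an end lies outside \<open>F\<close>, its coefficient is zero and the edge
      is not in the star of the other end, so both terms are divisible separately.\<close>
    have star: "a \<in> F \<and> b \<in> F" if "{a, b} \<in> ?T a" "a \<in> F" for a b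
      using that by (auto simp: doubleton_eq_iff)
    have "Var u - Var v dvd \<eta> u"
    proof (cases "u \<in> F")
      case True
      then show ?thesis using star[of u v] False by (intro other[OF uv]) blast
    qed (simp add: \<eta>_def)
    moreover have "Var u - Var v dvd \<eta> v"
    proof (cases "v \<in> F")
      case True
      then show ?thesis using star[of v u] False
        by (intro other[OF uv]) (unfold insert_commute[of u], blast)
    qed (simp add: \<eta>_def)
    ultimately show ?thesis by (rule dvd_add)
  qed
  have "\<eta> \<in> log_numerators l E"
    unfolding log_numerators_def
  proof (intro CollectI conjI ballI allI impI)
    fix u v i assume "{u, v} \<in> E" "i \<noteq> u" "i \<noteq> v"
    then show "Var u - Var v dvd \<eta> i" by (intro other) (auto simp: doubleton_eq_iff)
  next
    fix i assume "i \<notin> {1..l}"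
    then have "i \<notin> F" using F(2) by blast
    then show "\<eta> i = 0" by (simp add: \<eta>_def)
  next
    fix u v assume "{u, v} \<in> E"
    then show "Var u - Var v dvd \<eta> u + \<eta> v" by (rule sum)
  qed (rule ring)
  moreover have "edge_prod E = vertex_prod i (F - {i}) * \<eta> i" if "i \<in> F" for i
    using r[OF that] that unfolding \<eta>_def by presburger
  moreover have "\<eta> i = 0" if "i \<notin> F" for i
    using that by (simp add: \<eta>_def)
  ultimately show ?thesis by blast
qed

section \<open>Leading coefficients at a vertex\<close>

definition nbrs :: "nat \<Rightarrow> nat set" where
  "nbrs v = {j. j < v \<and> {v, j} \<in> E}"

lemma finite_nbrs [simp]: "finite (nbrs v)" and not_in_nbrs [simp]: "v \<notin> nbrs v"
  by (auto simp: nbrs_def)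

lemma nbrs_subset: "nbrs v \<subseteq> {1..l}"
  using edgeD(3) by (auto simp: nbrs_def)

text \<open>The sum \<open>\<eta> i + \<eta> v\<close> vanishes on x_i = x_v. After removal of the
  common factor, restricting further to x_j = x_v kills the term of \<open>\<eta> i\<close> because
  of the edge \<open>{v, j}\<close>, while the factor in front of \<open>q\<close> survives because
  \<open>{i, j}\<close> is not an edge.\<close>

lemma leading_vanish:
  fixes \<eta> :: "nat \<Rightarrow> ('k::field) mpoly"
  assumes \<eta>: "\<eta> \<in> log_numerators l E"
    and q: "\<eta> v = edge_prod (E - (\<lambda>j. {v, j}) ` nbrs v) * q"
    and ij: "i \<in> nbrs v" "j \<in> nbrs v" "i \<noteq> j" "{i, j} \<notin> E"
  shows "subst (Var(i := Var v, j := Var v)) q = 0"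
proof -
  let ?T = "(\<lambda>j. {v, j}) ` nbrs v" and ?\<tau> = "Var(i := Var v, j := Var v) :: nat \<Rightarrow> 'k mpoly"
  \<comment> \<open>\<open>C\<close> collects the edge forms dividing both \<open>\<eta> v\<close>
    and \<open>\<eta> i\<close>; \<open>A\<close> and \<open>B\<close> give the further ones
    dividing \<open>\<eta> v\<close> and \<open>\<eta> i\<close> respectively.\<close>
  define C where "C = {e \<in> E - ?T. i \<notin> e}"
  define A where "A = {e \<in> E. i \<in> e \<and> e \<noteq> {v, i}}"
  define B where "B = {e \<in> ?T. e \<noteq> {v, i}}"
  have iv: "{v, i} \<in> E" "i \<noteq> v" "j \<noteq> v" using ij by (auto simp: nbrs_def)
  have vi: "{i, v} \<in> E" "{v, j} \<in> E" using iv ij by (auto simp: nbrs_def insert_commute)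
  have T: "?T \<subseteq> E" by (auto simp: nbrs_def)
  have T_i: "e = {v, i}" if "e \<in> ?T" "i \<in> e" for e
    using that iv by auto
  have "E - ?T = C \<union> A" "C \<inter> A = {}"
    using T_i ij(1) unfolding A_def C_def by auto
  moreover have fin: "finite A" "finite B" "finite C"
    using finite_edges by (auto simp: A_def B_def C_def)
  ultimately have 1: "\<eta> v = edge_prod C * (edge_prod A * q)"
    using q by (simp add: edge_prod_Un mult.assoc)
  have "edge_prod {e \<in> E. i \<notin> e} dvd \<eta> i"
  proof (rule edge_prod_dvd)
    fix e assume e: "e \<in> {e \<in> E. i \<notin> e}"
    then obtain a b where "e = {a, b}" by (blast elim: edgeE)
    then show "edge_form e dvd \<eta> i" using \<eta> e by (auto simp: log_numerators_def)
  qed auto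
  moreover have "{e \<in> E. i \<notin> e} = C \<union> B" "C \<inter> B = {}"
    using T_i T iv unfolding B_def C_def by auto
  ultimately obtain s where "\<eta> i = edge_prod C * (edge_prod B * s)"
    using fin by (auto simp: edge_prod_Un dvd_def mult.assoc)
  with 1 have "\<eta> i + \<eta> v = edge_prod C * (edge_prod A * q + edge_prod B * s)"
    by (simp add: algebra_simps)
  moreover have "Var i - Var v dvd \<eta> i + \<eta> v"
    using \<eta> vi(1) unfolding log_numerators_def by blast
  moreover have "subst (Var(i := Var v)) (edge_prod C) \<noteq> (0 :: 'k mpoly)"
    using vi(1) by (intro subst_merge_edge_prod_neq_0) (auto simp: C_def)
  ultimately have "Var i - Var v dvd edge_prod A * q + edge_prod B * s"
    by (simp add: Var_diff_dvd_iff)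
  then obtain t where "edge_prod A * q + edge_prod B * s = (Var i - Var v) * t" ..
  then have "subst ?\<tau> (edge_prod A * q + edge_prod B * s) = subst ?\<tau> ((Var i - Var v) * t)"
    by simp
  then have sum0: "subst ?\<tau> (edge_prod A) * subst ?\<tau> q + subst ?\<tau> (edge_prod B) * subst ?\<tau> s = 0"
    using iv(2,3) by simp
  have "{v, j} \<in> B" using ij iv by (auto simp: B_def doubleton_eq_iff)
  moreover have "subst ?\<tau> (edge_form {v, j}) = 0" 
    using iv by (simp add: subst_edge_form_eq_0_iff)
  ultimately have B0: "subst ?\<tau> (edge_prod B) = 0"
    using fin(2) unfolding edge_prod_def subst_prod by (intro prod_zero) auto
  \<comment> \<open>The merge only collapses pairs among \<open>i\<close>, \<open>j\<close>,
    \<open>v\<close>; an edge of \<open>A\<close> joins \<open>i\<close> neither to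
    \<open>v\<close>, by the choice of \<open>A\<close>, nor to \<open>j\<close>, by
    hypothesis.\<close>
  have "subst ?\<tau> (edge_form e) \<noteq> 0" if "e \<in> A" for e
  proof -
    from that have e: "e \<in> E" "i \<in> e" "e \<noteq> {v, i}" by (simp_all add: A_def)
    obtain a b where "e = {a, b}" "a \<noteq> b" using e(1) by (rule edgeE)
    then have "e = {i, b} \<and> b \<noteq> i \<or> e = {i, a} \<and> a \<noteq> i" using e(2) by (auto simp: insert_commute)
    then obtain k where k: "e = {i, k}" "k \<noteq> i" by blast
    have "k \<noteq> v" using e(3) k(1) by (auto simp: insert_commute)
    moreover have "k \<noteq> j" using e(1) k(1) ij(4) by auto
    ultimately have "?\<tau> i \<noteq> ?\<tau> k" using k(2) by simp
    then show ?thesis unfolding k(1) subst_edge_form_eq_0_iff .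
  qed
  then have "subst ?\<tau> (edge_prod A) \<noteq> 0"
    using fin(1) by (simp add: edge_prod_def)
  with sum0 B0 show ?thesis by simp
qed

text \<open>The equation expresses, free of fractions, \<open>\<eta> v / edge_prod E\<close> as
  \<open>p\<close> in shifted coordinates over \<open>vertex_prod v (nbrs v)\<close>: the factors of
  all other edges cancel. The clique condition is \<open>leading_vanish\<close> read in these
  coordinates.\<close>

lemma leading_coefficient:
  fixes \<eta> :: "nat \<Rightarrow> ('k::field) mpoly"
  assumes \<eta>: "\<eta> \<in> log_numerators l E" and v: "v \<in> {1..l}" and above: "\<And>i. i > v \<Longrightarrow> \<eta> i = 0"
  shows "\<exists>p\<in>poly_ring l. \<eta> v * vertex_prod v (nbrs v) = subst (shift v) p * edge_prod E \<and>
    (\<forall>b\<in>keys p. clique {k \<in> nbrs v. lookup b k = 0} E)"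
proof -
  let ?T = "(\<lambda>j. {v, j}) ` nbrs v"
  have T: "?T \<subseteq> E" by (auto simp: nbrs_def)
  have "edge_prod (E - ?T) dvd \<eta> v"
  proof (rule edge_prod_dvd)
    fix e assume e: "e \<in> E - ?T"
    then obtain a b where ab: "e = {a, b}" "a \<noteq> b" by (blast elim: edgeE)
    show "edge_form e dvd \<eta> v"
    proof (cases "v \<in> e")
      case True
      then obtain w where w: "e = {v, w}" "w \<noteq> v" using ab by blast
      \<comment> \<open>\<open>e\<close> lies outside \<open>?T\<close>, so \<open>w\<close> is not
        a lower neighbour of \<open>v\<close>, and the coefficient at \<open>w\<close> is zero by
        hypothesis.\<close>
      then have "w > v" using e unfolding nbrs_def by (metis (mono_tags, lifting) Diff_iff imageI linorder_neqE_nat mem_Collect_eq)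
      then have "\<eta> v + \<eta> w = \<eta> v" using above by simp
      moreover have "Var v - Var w dvd \<eta> v + \<eta> w" using \<eta> e w by (auto simp: log_numerators_def)
      ultimately show ?thesis by (simp add: w)
    next
      case False
      then show ?thesis using \<eta> e ab by (auto simp: log_numerators_def)
    qed
  qed auto
  then obtain q where q: "\<eta> v = edge_prod (E - ?T) * q" ..
  obtain c where c: "c * c = 1" "edge_prod ?T = c * (vertex_prod v (nbrs v) :: 'k mpoly)"
    using edge_prod_star[of v "nbrs v"] by auto
  have D: "edge_prod E = edge_prod ?T * (edge_prod (E - ?T) :: 'k mpoly)"
    using edge_prod_Un[of ?T "E - ?T"] T by (simp add: Un_absorb1)
  \<comment> \<open>This is \<open>q\<close> in the shifted coordinates, as \<open>shift\<close> is
    an involution; \<open>c\<close> absorbs the orientation signs.\<close>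
  define p where "p = subst (shift v) (c * q)"
  have p: "subst (shift v) p = c * q" by (simp add: p_def)
  have "c * q * edge_prod E = (c * c) * (q * vertex_prod v (nbrs v) * edge_prod (E - ?T))"
    unfolding D c(2) by (simp only: mult_ac)
  then have eq: "\<eta> v * vertex_prod v (nbrs v) = subst (shift v) p * edge_prod E"
    unfolding p q c(1) by (simp only: mult_1_left mult_ac)
  have "edge_prod E * subst (shift v) p \<in> poly_ring l"
  proof -
    have "\<eta> v \<in> poly_ring l" using \<eta> v by (auto simp: log_numerators_def)
    moreover have "vertex_prod v (nbrs v) \<in> poly_ring l"
      unfolding vertex_prod_def
      by (intro poly_ring_prod poly_ring_diff poly_ring_Var) (use v nbrs_subset in blast)+
    ultimately have "\<eta> v * vertex_prod v (nbrs v) \<in> poly_ring l" by (rule poly_ring_mult)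
    then show ?thesis unfolding eq by (simp add: mult.commute)
  qed
  then have "subst (shift v) p \<in> poly_ring l"
    by (rule poly_ring_cancel) (auto intro: edge_prod_poly_ring)
  then have ring: "p \<in> poly_ring l"
    using subst_shift_poly_ring[OF v] by fastforce
  have "{i, j} \<in> E" if b: "b \<in> keys p" and ij: "i \<in> nbrs v" "j \<in> nbrs v" "lookup b i = 0" "lookup b j = 0" "i \<noteq> j" for b i j
  proof (rule ccontr)
    assume nE: "{i, j} \<notin> E"
    \<comment> \<open>Setting the shifted variables \<open>i\<close> and \<open>j\<close> to zero is
      restriction to x_i = x_j = x_v. There the polynomial vanishes, whereas the term at
      \<open>b\<close>, which omits both variables, would survive.\<close>
    let ?\<psi> = "\<lambda>k. if k \<in> {i, j} then 0 else Var k :: 'k mpoly"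
    let ?\<tau> = "Var(i := Var v, j := Var v) :: nat \<Rightarrow> 'k mpoly"
    have neq: "i \<noteq> v" "j \<noteq> v" using ij by (auto simp: nbrs_def)
    have "(\<lambda>k. subst (shift v) (?\<psi> k)) = (\<lambda>k. subst ?\<tau> (shift v k))"
      using neq by (auto simp: shift_def fun_eq_iff)
    then have "subst (shift v) (subst ?\<psi> p) = subst ?\<tau> (subst (shift v) p)"
      by (simp add: subst_subst)
    also have "\<dots> = 0"
      using leading_vanish[OF \<eta> q ij(1,2,5) nE] by (simp add: p)
    finally have "subst ?\<psi> p = 0" by simp
    moreover have "keys b \<inter> {i, j} = {}" using ij by (auto simp: in_keys_iff)
    ultimately have "lookup p b = 0" using lookup_subst_zero[of "{i, j}" p b] by simp
    then show False using b by (simp add: in_keys_iff)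
  qed
  then have "\<forall>b\<in>keys p. clique {k \<in> nbrs v. lookup b k = 0} E"
    by (auto simp: clique_def)
  with eq ring show ?thesis by blast
qed

end

section \<open>A basis of the graded parts\<close>

text \<open>Independence is assumed of the family rather than of its image, so distinct indices give
  distinct forms and the basis can be counted by its index set.\<close>

lemma form_independent_family:
  fixes f :: "'i \<Rightarrow> ('k::field) form1"
  assumes I: "finite I" and *: "\<And>c. (\<Sum>x\<in>I. form_scale (c x) (f x)) = 0 \<Longrightarrow> \<forall>x\<in>I. c x = 0"
  shows "inj_on f I" "form.independent (f ` I)"
proof -
  show inj: "inj_on f I"
  proof (rule inj_onI, rule ccontr)
    fix x y assume xy: "x \<in> I" "y \<in> I" "f x = f y" "x \<noteq> y"
    define c where "c z = (if z = x then 1 else 0) - (if z = y then 1 else 0 :: 'k)" for z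
    have "form_scale (c z) (f z) = (if z = x then f x else 0) - (if z = y then f y else 0)" for z
      by (simp add: c_def form.scale_left_diff_distrib)
    then have "(\<Sum>z\<in>I. form_scale (c z) (f z)) = f x - f y"
      using I xy(1,2) by (simp add: sum_subtractf sum.delta)
    then have "c x = 0" using * xy by auto
    then show False using xy by (simp add: c_def)
  qed
  have "\<forall>v\<in>f ` I. u v = 0" if "(\<Sum>v\<in>f ` I. form_scale (u v) v) = 0" for u
    using *[of "u \<circ> f"] that by (simp add: sum.reindex[OF inj])
  then show "form.independent (f ` I)"
    unfolding form.dependent_finite[OF finite_imageI[OF I]] by blast
qed

lemma sum_fun_apply: "(\<Sum>x\<in>A. f x) i = (\<Sum>x\<in>A. f x i)"
  by (induction A rule: infinite_finite_induct) auto

lemma form_scale_apply: "form_scale c \<omega> i = const c * \<omega> i"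
  by (simp add: form_scale_def form_mult_def)

section \<open>Squarefree monomials and the candidate basis\<close>

definition indicator_exponent :: "nat set \<Rightarrow> nat \<Rightarrow>\<^sub>0 nat" where
  "indicator_exponent A = (\<Sum>k\<in>A. single k 1)"

lemma lookup_indicator_exponent:
  "finite A \<Longrightarrow> lookup (indicator_exponent A) k = (if k \<in> A then 1 else 0)"
  by (simp add: indicator_exponent_def lookup_sum lookup_single when_def sum.delta)

lemma keys_indicator_exponent: "finite A \<Longrightarrow> keys (indicator_exponent A) = A"
  by (auto simp: in_keys_iff lookup_indicator_exponent split: if_splits)

lemma monomial_degree_indicator_exponent:
  "finite A \<Longrightarrow> monomial_degree (indicator_exponent A) = card A"
  by (simp add: monomial_degree_def keys_indicator_exponent lookup_indicator_exponent)

lemma subst_shift_indicator_exponent: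
  assumes "v \<notin> A"
  shows "subst (shift v) (single (indicator_exponent A) 1) = (vertex_prod v A :: ('k::field) mpoly)"
proof -
  have "single (indicator_exponent A) 1 = (\<Prod>k\<in>A. Var k :: 'k mpoly)"
    by (simp add: indicator_exponent_def Var_def prod_single)
  then have "subst (shift v) (single (indicator_exponent A) 1) = (\<Prod>k\<in>A. shift v k :: 'k mpoly)"
    by simp
  also have "\<dots> = vertex_prod v A"
    unfolding vertex_prod_def using assms by (intro prod.cong) (auto simp: shift_def)
  finally show ?thesis .
qed

text \<open>The clique form of \<open>F\<close>, multiplied by the monomial \<open>b\<close> in the
  coordinates centred at \<open>Max F\<close>.\<close>

definition basis_form :: "nat set \<times> (nat \<Rightarrow>\<^sub>0 nat) \<Rightarrow> ('k::field) form1" where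
  "basis_form = (\<lambda>(F, b) i. if i \<in> F
     then to_fract (subst (shift (Max F)) (single b 1)) / to_fract (vertex_prod i (F - {i})) else 0)"

context simple_graph
begin

definition log_module :: "('k::field) form1 set" where
  "log_module = (\<lambda>\<eta> i. to_fract (\<eta> i) / to_fract (edge_prod E)) ` log_numerators l E"

lemma log_moduleI: "\<eta> \<in> log_numerators l E \<Longrightarrow> (\<lambda>i. to_fract (\<eta> i) / to_fract (edge_prod E)) \<in> log_module"
  unfolding log_module_def by (rule image_eqI[OF refl])

text \<open>The clique form has degree \<open>1 - card F\<close>, which fixes the degree of the
  monomial. Excluding \<open>F - {Max F}\<close> leaves \<open>l - card F + 1\<close> variables, the
  exponent in the Hilbert series.\<close>

definition basis_index :: "int \<Rightarrow> (nat set \<times> (nat \<Rightarrow>\<^sub>0 nat)) set" where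
  "basis_index d = (SIGMA F:clique_complex l E - {{}}.
     {b. keys b \<subseteq> {1..l} - (F - {Max F}) \<and> int (monomial_degree b) = d + int (card F) - 1})"

text \<open>
  The exponent of the leading coefficient of \<open>basis_form (F, b)\<close>, in the shifted coordinates and
  over the denominator \<open>vertex_prod v (nbrs v)\<close>, where \<open>v = Max F\<close>.
\<close>

definition top_exponent :: "nat set \<times> (nat \<Rightarrow>\<^sub>0 nat) \<Rightarrow> nat \<Rightarrow>\<^sub>0 nat" where
  "top_exponent = (\<lambda>(F, b). b + indicator_exponent (nbrs (Max F) - F))"

lemma clique_complexD:
  assumes "F \<in> clique_complex l E - {{}}"
  shows "finite F" "Max F \<in> F" "F \<subseteq> {1..l}" "clique F E" "F - {Max F} \<subseteq> nbrs (Max F)"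
    "Max F \<in> {1..l}"
proof -
  show F: "F \<subseteq> {1..l}" "clique F E" using assms by (auto simp: clique_complex_def)
  then show fin: "finite F" using finite_subset by blast
  show v: "Max F \<in> F" using fin assms by simp
  then show "Max F \<in> {1..l}" using F by blast
  show "F - {Max F} \<subseteq> nbrs (Max F)"
  proof
    fix j assume "j \<in> F - {Max F}"
    then show "j \<in> nbrs (Max F)"
      using F(2) v Max_ge[OF fin, of j] by (auto simp: nbrs_def clique_def)
  qed
qed

lemma finite_clique_complex: "finite (clique_complex l E)"
  by (rule finite_subset[of _ "Pow {1..l}"]) (auto simp: clique_complex_def)

lemma basis_index_fibre:
  "{b. keys b \<subseteq> A \<and> int (monomial_degree b) = e} = (if e < 0 then {} else exponents A (nat e))"
  by (auto simp: exponents_def)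

lemma finite_basis_index: "finite (basis_index d)"
  unfolding basis_index_def
  by (intro finite_SigmaI) (auto simp: finite_clique_complex basis_index_fibre)

lemma log_module_add: "\<omega> \<in> log_module \<Longrightarrow> \<theta> \<in> log_module \<Longrightarrow> \<omega> + \<theta> \<in> log_module"
  unfolding log_module_def using log_numerators_add
  by (force simp: image_iff plus_fun_def simp flip: add_divide_distrib to_fract_add)

lemma log_module_mult:
  assumes "\<omega> \<in> log_module" "p \<in> poly_ring l"
  shows "(\<lambda>i. to_fract p * \<omega> i) \<in> log_module"
proof -
  obtain \<eta> where \<eta>: "\<eta> \<in> log_numerators l E" "\<omega> = (\<lambda>i. to_fract (\<eta> i) / to_fract (edge_prod E))"
    using assms(1) unfolding log_module_def by blast
  show ?thesis
    unfolding log_module_def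
    by (rule image_eqI[OF _ log_numerators_mult[OF \<eta>(1) assms(2)]]) (simp add: \<eta>(2))
qed

lemma graded_part_add:
  "\<omega> \<in> graded_part log_module d \<Longrightarrow> \<theta> \<in> graded_part log_module d \<Longrightarrow> \<omega> + \<theta> \<in> graded_part log_module d"
  by (simp add: graded_part_def log_module_add homogeneous_ratfun_add)

lemma graded_part_scale:
  assumes "\<omega> \<in> graded_part log_module d"
  shows "form_scale c \<omega> \<in> graded_part log_module d"
proof -
  have "form_scale c \<omega> = (\<lambda>i. to_fract (single 0 c) * \<omega> i)"
    by (simp add: fun_eq_iff form_scale_apply const_def)
  then have "form_scale c \<omega> \<in> log_module"
    using assms log_module_mult[of \<omega> "single 0 c"] by (simp add: graded_part_def)
  moreover have "homogeneous_ratfun (0 + d) (const c * \<omega> i)" for i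
    using assms by (intro homogeneous_ratfun_mult homogeneous_ratfun_const) (simp add: graded_part_def)
  ultimately show ?thesis by (simp add: graded_part_def form_scale_apply)
qed

text \<open>With \<open>\<omega>\<close> as initial value, the empty and the infinite sum reduce to
  the first hypothesis.\<close>

lemma graded_part_add_sum:
  assumes "\<omega> \<in> graded_part log_module d" "\<And>x. x \<in> A \<Longrightarrow> \<theta> x \<in> graded_part log_module d"
  shows "\<omega> + (\<Sum>x\<in>A. form_scale (c x) (\<theta> x)) \<in> graded_part log_module d"
  using assms(2)
proof (induction A rule: infinite_finite_induct)
  case (insert x A)
  have "(\<omega> + (\<Sum>x\<in>A. form_scale (c x) (\<theta> x))) + form_scale (c x) (\<theta> x) \<in> graded_part log_module d"
    using insert.IH insert.prems by (blast intro: graded_part_add graded_part_scale)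
  then show ?case
    by (simp only: sum.insert[OF insert.hyps] add_ac)
next
  case (infinite A)
  then show ?case by (simp only: sum.infinite[OF infinite.hyps] add_0_right assms(1))
qed (simp only: sum.empty add_0_right assms(1))

lemma basis_form_graded:
  assumes "x \<in> basis_index d"
  shows "(basis_form x :: ('k::field) form1) \<in> graded_part log_module d"
proof -
  obtain F b where x: "x = (F, b)" "F \<in> clique_complex l E - {{}}"
    "keys b \<subseteq> {1..l} - (F - {Max F})" "int (monomial_degree b) = d + int (card F) - 1"
    using assms by (auto simp: basis_index_def)
  note F = clique_complexD[OF x(2)]
  obtain \<eta> where \<eta>: "\<eta> \<in> log_numerators l E" "\<And>i. i \<notin> F \<Longrightarrow> \<eta> i = 0"
    "\<And>i. i \<in> F \<Longrightarrow> edge_prod E = vertex_prod i (F - {i}) * (\<eta> i :: 'k mpoly)"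
    using ex_clique_numerator[OF F(4,3)] by blast
  let ?p = "subst (shift (Max F)) (single b 1) :: 'k mpoly"
  have eq: "basis_form x = (\<lambda>i. to_fract ?p * (to_fract (\<eta> i) / to_fract (edge_prod E)))"
  proof
    fix i
    show "basis_form x i = to_fract ?p * (to_fract (\<eta> i) / to_fract (edge_prod E))"
    proof (cases "i \<in> F")
      case True
      have "edge_prod E \<noteq> (0 :: 'k mpoly)" by simp
      \<comment> \<open>A factor of the nonzero \<open>edge_prod E\<close> is nonzero and may be
        cancelled from the fraction.\<close>
      then have "to_fract (\<eta> i) \<noteq> 0"
        unfolding \<eta>(3)[OF True] mult_eq_0_iff to_fract_eq_0_iff by blast
      then have "to_fract (\<eta> i) / to_fract (edge_prod E) = 1 / to_fract (vertex_prod i (F - {i}))"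
        unfolding \<eta>(3)[OF True] to_fract_mult by simp
      then show ?thesis using True by (simp add: x(1) basis_form_def)
    qed (simp add: x(1) basis_form_def \<eta>(2))
  qed
  have "single b 1 \<in> poly_ring l"
    using x(3) unfolding poly_ring_def by auto
  then have "?p \<in> poly_ring l" using F(6) by (intro subst_shift_poly_ring)
  then have "(basis_form x :: 'k form1) \<in> log_module"
    unfolding eq using \<eta>(1) by (intro log_module_mult) (simp_all only: log_moduleI)
  moreover have "homogeneous_ratfun d ((basis_form x :: 'k form1) i)" for i
  proof (cases "i \<in> F")
    case True
    have "homogeneous_ratfun d (to_fract ?p / to_fract (vertex_prod i (F - {i})))"
    proof (rule homogeneous_ratfunI)
      show "homogeneous (monomial_degree b) ?p"
        by (intro homogeneous_shift homogeneous_single)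
      show "homogeneous (card (F - {i})) (vertex_prod i (F - {i}) :: 'k mpoly)"
        by (rule homogeneous_vertex_prod)
      \<comment> \<open>The denominator at \<open>i\<close> has one factor fewer than
        \<open>F\<close> has elements, whence the \<open>- 1\<close> in
        \<open>basis_index\<close>.\<close>
      have "card F = Suc (card (F - {i}))" using card.remove[OF F(1) True] .
      then show "d = int (monomial_degree b) - int (card (F - {i}))" using x(4) by simp
    qed (simp add: vertex_prod_neq_0)
    then show ?thesis using True by (simp add: x(1) basis_form_def)
  qed (simp add: x(1) basis_form_def homogeneous_ratfun_0)
  ultimately show ?thesis by (simp add: graded_part_def)
qed

section \<open>Leading terms of the basis forms\<close>

lemma basis_form_above:
  assumes "x \<in> basis_index d" "i > Max (fst x)"
  shows "basis_form x i = 0"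
proof -
  have "fst x \<in> clique_complex l E - {{}}" using assms(1) by (auto simp: basis_index_def)
  from clique_complexD(1)[OF this] have "i \<notin> fst x" using assms(2) Max_ge by fastforce
  then show ?thesis by (cases x) (simp add: basis_form_def)
qed

text \<open>Expanding by the product over the lower neighbours of \<open>v\<close> outside
  \<open>F\<close>, a squarefree monomial in shifted coordinates, brings all leading coefficients at
  \<open>v\<close> to one denominator.\<close>

lemma basis_form_top:
  assumes x: "x \<in> basis_index d" and v: "v = Max (fst x)"
  shows "basis_form x v = to_fract (subst (shift v) (single (top_exponent x) 1))
    / (to_fract (vertex_prod v (nbrs v)) :: ('k::field) ratfun)"
proof -
  obtain F b where Fb: "x = (F, b)" "F \<in> clique_complex l E - {{}}"
    using x by (auto simp: basis_index_def)
  note F = clique_complexD[OF Fb(2)]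
  have vF: "v = Max F" using v Fb by simp
  let ?A = "nbrs v - F"
  have "nbrs v = (F - {v}) \<union> ?A" "(F - {v}) \<inter> ?A = {}" using F(5) unfolding vF by auto
  moreover have "finite (F - {v})" "finite ?A" using F(1) by auto
  ultimately have split: "vertex_prod v (nbrs v) = vertex_prod v (F - {v}) * (vertex_prod v ?A :: 'k mpoly)"
    unfolding vertex_prod_def by (metis prod.union_disjoint)
  have "single (top_exponent x) 1 = single b 1 * (single (indicator_exponent ?A) 1 :: 'k mpoly)"
    by (simp add: top_exponent_def Fb(1) vF mult_single)
  then have "subst (shift v) (single (top_exponent x) 1)
      = subst (shift v) (single b 1) * (vertex_prod v ?A :: 'k mpoly)"
    by (simp add: subst_shift_indicator_exponent)
  moreover have "vertex_prod v ?A \<noteq> (0 :: 'k mpoly)" by (simp add: vertex_prod_neq_0)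
  ultimately show ?thesis
    using F(2) split by (simp add: Fb(1) basis_form_def vF)
qed

text \<open>\<open>b\<close> omits the members of \<open>F\<close> below its maximum, and the added
  indicator is 1 at every other lower neighbour. So the clique can be recovered from the leading
  exponent.\<close>

lemma top_exponent_zeros:
  assumes "x \<in> basis_index d"
  shows "fst x = insert (Max (fst x)) {k \<in> nbrs (Max (fst x)). lookup (top_exponent x) k = 0}"
proof -
  obtain F b where x: "x = (F, b)" "F \<in> clique_complex l E - {{}}" "keys b \<subseteq> {1..l} - (F - {Max F})"
    using assms by (auto simp: basis_index_def)
  note F = clique_complexD[OF x(2)]
  have "lookup (top_exponent x) k = 0 \<longleftrightarrow> k \<in> F" if k: "k \<in> nbrs (Max F)" for k
  proof -
    have "lookup (top_exponent x) k = lookup b k + (if k \<in> F then 0 else 1)"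
      using k by (simp add: top_exponent_def x(1) lookup_add lookup_indicator_exponent)
    moreover have "lookup b k = 0" if "k \<in> F"
    proof -
      have "k \<noteq> Max F" using k by (auto simp: nbrs_def)
      then have "k \<notin> keys b" using that x(3) by blast
      then show ?thesis by (simp add: in_keys_iff)
    qed
    ultimately show ?thesis by auto
  qed
  then have "{k \<in> nbrs (Max F). lookup (top_exponent x) k = 0} = nbrs (Max F) \<inter> F" by blast
  then have "insert (Max F) {k \<in> nbrs (Max F). lookup (top_exponent x) k = 0} = F"
    using F(2,5) by blast
  then show ?thesis unfolding x(1) fst_conv by (rule sym)
qed

lemma top_exponent_inj:
  assumes "x \<in> basis_index d" "y \<in> basis_index d" "Max (fst x) = Max (fst y)"
    "top_exponent x = top_exponent y"
  shows "x = y"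
proof -
  have "fst x = fst y"
    by (rule trans[OF top_exponent_zeros[OF assms(1), unfolded assms(3,4)]
          top_exponent_zeros[OF assms(2), symmetric]])
  then show ?thesis
    using assms(4) by (cases x; cases y) (simp add: top_exponent_def)
qed

text \<open>The clique is \<open>v\<close> together with the lower neighbours where \<open>b\<close>
  is zero. At the remaining lower neighbours \<open>b\<close> is at least 1, so the indicator can be
  subtracted without truncation.\<close>

lemma top_exponent_surj:
  assumes v: "v \<in> {1..l}" and b: "keys b \<subseteq> {1..l}" "clique {k \<in> nbrs v. lookup b k = 0} E"
    "int (monomial_degree b) = d + int (card (nbrs v))"
  shows "\<exists>x\<in>basis_index d. Max (fst x) = v \<and> top_exponent x = b"
proof -
  let ?Z = "{k \<in> nbrs v. lookup b k = 0}"
  define F where "F = insert v ?Z"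
  define b' where "b' = b - indicator_exponent (nbrs v - ?Z)"
  have fin: "finite ?Z" by simp
  have Max: "Max F = v"
    unfolding F_def using fin by (intro Max_eqI) (auto simp: nbrs_def)
  have vZ: "v \<notin> ?Z" by simp
  have "clique F E"
    using b(2) by (auto simp: F_def clique_def nbrs_def insert_commute)
  then have F: "F \<in> clique_complex l E - {{}}"
    using v nbrs_subset by (auto simp: F_def clique_complex_def)
  have diff: "nbrs v - F = nbrs v - ?Z" by (auto simp: F_def)
  have b_eq: "b = b' + indicator_exponent (nbrs v - ?Z)"
    unfolding b'_def
    by (intro poly_mapping_eqI) (auto simp: lookup_add lookup_minus lookup_indicator_exponent)
  have "keys b' \<subseteq> {1..l} - ?Z"
  proof
    fix k assume k: "k \<in> keys b'"
    then have "k \<in> keys (b' + indicator_exponent (nbrs v - ?Z))" by (simp only: keys_add_nat UnI1)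
    then have kb: "k \<in> keys b" unfolding b_eq[symmetric] .
    then have "lookup b k \<noteq> 0" by (simp add: in_keys_iff)
    then show "k \<in> {1..l} - ?Z" using b(1) kb by blast
  qed
  moreover have "F - {v} = ?Z" using vZ by (auto simp: F_def)
  moreover have "int (monomial_degree b') = d + int (card F) - 1"
  proof -
    have "monomial_degree b = monomial_degree b' + card (nbrs v - ?Z)"
      by (subst b_eq) (simp add: monomial_degree_indicator_exponent)
    moreover have "card (nbrs v - ?Z) + card ?Z = card (nbrs v)"
      using card_Diff_subset[OF fin, of "nbrs v"] card_mono[OF finite_nbrs, of ?Z v] by auto
    moreover have "card F = Suc (card ?Z)" using vZ fin by (simp add: F_def)
    ultimately show ?thesis using b(3) by linarith
  qed
  ultimately have "(F, b') \<in> basis_index d" using F by (simp add: basis_index_def Max)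
  moreover have "top_exponent (F, b') = b"
    using b_eq by (simp add: top_exponent_def Max diff)
  ultimately show ?thesis using Max by (intro bexI[of _ "(F, b')"]) auto
qed

text \<open>At the largest \<open>Max F\<close> that occurs with a nonzero coefficient, only the
  forms with this maximum contribute, and over the common denominator their leading coefficients are
  distinct monomials in shifted coordinates.\<close>

lemma basis_form_independent:
  assumes sum0: "(\<Sum>x\<in>basis_index d. form_scale (c x) (basis_form x)) = (0 :: ('k::field) form1)"
  shows "\<forall>x\<in>basis_index d. c x = 0"
proof (rule ccontr)
  assume "\<not> ?thesis"
  then have ne: "{x \<in> basis_index d. c x \<noteq> 0} \<noteq> {}" by blast
  let ?I = "{x \<in> basis_index d. c x \<noteq> 0}" and ?M = "\<lambda>x :: nat set \<times> (nat \<Rightarrow>\<^sub>0 nat). Max (fst x)"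
  define v where "v = Max (?M ` ?I)"
  have fin: "finite ?I" using finite_basis_index by simp
  then have "v \<in> ?M ` ?I" unfolding v_def using ne by (intro Max_in) auto
  then obtain x0 where x0: "x0 \<in> basis_index d" "c x0 \<noteq> 0" "?M x0 = v" by auto
  have le: "?M x \<le> v" if "x \<in> ?I" for x
    unfolding v_def using fin that by (intro Max_ge) auto
  let ?J = "{x \<in> basis_index d. ?M x = v}" and ?V = "to_fract (vertex_prod v (nbrs v)) :: 'k ratfun"
  have finJ: "finite ?J" using finite_basis_index by simp
  have "0 = (\<Sum>x\<in>basis_index d. form_scale (c x) (basis_form x)) v"
    unfolding sum0 by simp
  also have "\<dots> = (\<Sum>x\<in>basis_index d. const (c x) * basis_form x v)"
    by (simp add: sum_fun_apply form_scale_apply)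
  also have "\<dots> = (\<Sum>x\<in>?J. const (c x) * basis_form x v)"
  proof (rule sum.mono_neutral_right)
    show "\<forall>x\<in>basis_index d - ?J. const (c x) * basis_form x v = 0"
    proof
      fix x assume x: "x \<in> basis_index d - ?J"
      show "const (c x) * basis_form x v = 0"
      proof (cases "c x = 0")
        case False
        then have "?M x < v" using le[of x] x by auto
        then have "basis_form x v = (0 :: 'k ratfun)" using x by (intro basis_form_above) auto
        then show ?thesis by simp
      qed (simp add: const_def)
    qed
  qed (use finite_basis_index in auto)
  also have "\<dots> = (\<Sum>x\<in>?J. to_fract (subst (shift v) (single 0 (c x) * single (top_exponent x) 1)) / ?V)"
  proof (rule sum.cong)
    fix x assume x: "x \<in> ?J"
    then have "basis_form x v = to_fract (subst (shift v) (single (top_exponent x) 1)) / ?V"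
      by (intro basis_form_top[of x d]) auto
    then show "const (c x) * basis_form x v
        = to_fract (subst (shift v) (single 0 (c x) * single (top_exponent x) 1)) / ?V"
      by (simp add: const_def)
  qed simp
  also have "\<dots> = to_fract (subst (shift v) (\<Sum>x\<in>?J. single (top_exponent x) (c x))) / ?V"
    by (simp add: mult_single sum_divide_distrib del: subst_mult)
  finally have "subst (shift v) (\<Sum>x\<in>?J. single (top_exponent x) (c x)) = 0"
    by (simp add: vertex_prod_neq_0 del: subst_sum)
  then have "(\<Sum>x\<in>?J. single (top_exponent x) (c x)) = 0"
    by (simp only: subst_shift_eq_0_iff)
  then have "0 = lookup (\<Sum>x\<in>?J. single (top_exponent x) (c x)) (top_exponent x0)" by simp
  also have "\<dots> = (\<Sum>x\<in>?J. if x = x0 then c x0 else 0)"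
    unfolding lookup_sum
  proof (rule sum.cong)
    fix x assume x: "x \<in> ?J"
    then have "top_exponent x = top_exponent x0 \<longleftrightarrow> x = x0"
      using top_exponent_inj[of x d x0] x0 by auto
    then show "lookup (single (top_exponent x) (c x)) (top_exponent x0) = (if x = x0 then c x0 else 0)"
      by (simp add: lookup_single when_def)
  qed simp
  also have "\<dots> = c x0" using x0 finJ by (simp add: sum.delta)
  finally show False using x0 by simp
qed

text \<open>Induction on a bound for the highest nonzero coefficient: each monomial of the leading
  numerator is the leading monomial of a basis form, and cancelling all of them lowers the bound by
  one.\<close>

lemma basis_form_span_aux:
  assumes "v \<le> l" "\<omega> \<in> graded_part log_module d" "\<And>i. i > v \<Longrightarrow> \<omega> i = (0 :: ('k::field) ratfun)"
  shows "\<omega> \<in> form.span (basis_form ` basis_index d)"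
  using assms
proof (induction v arbitrary: \<omega>)
  case 0
  \<comment> \<open>Only the index 0 is not covered by the hypothesis, and it lies outside
    \<open>{1..l}\<close>.\<close>
  have "\<omega> i = 0" for i
  proof (cases i)
    case 0
    then show ?thesis using \<open>\<omega> \<in> _\<close> by (auto simp: graded_part_def log_module_def log_numerators_def)
  qed (use 0 in auto)
  then have "\<omega> = 0" by auto
  then show ?case by (simp only: form.span_zero)
next
  case (Suc w)
  let ?v = "Suc w"
  have v: "?v \<in> {1..l}" using Suc.prems(1) by simp
  let ?V = "vertex_prod ?v (nbrs ?v) :: 'k mpoly"
  have V0: "?V \<noteq> 0" by (simp add: vertex_prod_neq_0)
  obtain \<eta> where \<eta>: "\<eta> \<in> log_numerators l E" "\<omega> = (\<lambda>i. to_fract (\<eta> i) / to_fract (edge_prod E))"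
    using Suc.prems(2) by (auto simp: graded_part_def log_module_def)
  have "\<eta> i = 0" if "i > ?v" for i
    using Suc.prems(3)[OF that] by (simp add: \<eta>(2))
  then obtain p where p: "p \<in> poly_ring l" "\<eta> ?v * ?V = subst (shift ?v) p * edge_prod E"
    "\<And>b. b \<in> keys p \<Longrightarrow> clique {k \<in> nbrs ?v. lookup b k = 0} E"
    using leading_coefficient[OF \<eta>(1) v] by blast
  have "to_fract (\<eta> ?v) * to_fract ?V = to_fract (subst (shift ?v) p) * to_fract (edge_prod E)"
    using p(2) by (simp flip: to_fract_mult)
  then have \<omega>v: "\<omega> ?v = to_fract (subst (shift ?v) p) / to_fract ?V"
    using V0 by (simp add: \<eta>(2) field_simps)
  then have hom: "homogeneous_ratfun d (to_fract (subst (shift ?v) p) / to_fract ?V)"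
    using Suc.prems(2) by (metis (mono_tags, lifting) graded_part_def mem_Collect_eq)
  \<comment> \<open>The fraction controls the degrees of the shifted polynomial; applying the
    involution once more, which preserves homogeneity, transfers them to \<open>p\<close>.\<close>
  have deg: "int (monomial_degree b) = d + int (card (nbrs ?v))" if b: "b \<in> keys p" for b
  proof -
    note degs = homogeneous_ratfun_cancel[OF hom homogeneous_vertex_prod V0]
    have "subst (shift ?v) p \<noteq> 0" using b by auto
    then obtain b0 where "b0 \<in> keys (subst (shift ?v) p)" by fastforce
    then have b0: "int (monomial_degree b0) = d + int (card (nbrs ?v))" by (rule degs)
    have "homogeneous (monomial_degree b0) (subst (shift ?v) p)"
      unfolding homogeneous_def using degs b0 by (metis of_nat_eq_iff)
    then have "homogeneous (monomial_degree b0) (subst (shift ?v) (subst (shift ?v) p))"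
      by (rule homogeneous_shift)
    then have "monomial_degree b = monomial_degree b0" using b by (simp add: homogeneous_def)
    then show ?thesis using b0 by simp
  qed
  have "\<exists>x\<in>basis_index d. Max (fst x) = ?v \<and> top_exponent x = b" if b: "b \<in> keys p" for b
    using p(1) b by (intro top_exponent_surj[OF v _ p(3) deg]) (auto simp: poly_ring_def)
  then obtain g where g: "\<And>b. b \<in> keys p \<Longrightarrow> g b \<in> basis_index d"
    "\<And>b. b \<in> keys p \<Longrightarrow> Max (fst (g b)) = ?v" "\<And>b. b \<in> keys p \<Longrightarrow> top_exponent (g b) = b"
    by metis
  \<comment> \<open>The coefficients are negated so that \<open>\<omega> + \<theta>\<close> vanishes
    at \<open>?v\<close>.\<close>
  define \<theta> :: "'k form1" where "\<theta> = (\<Sum>b\<in>keys p. form_scale (- lookup p b) (basis_form (g b)))"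
  have \<theta>_apply: "\<theta> i = (\<Sum>b\<in>keys p. const (- lookup p b) * basis_form (g b) i)" for i
    by (simp only: \<theta>_def sum_fun_apply form_scale_apply)
  have "\<theta> ?v = (\<Sum>b\<in>keys p. to_fract (subst (shift ?v) (single b (- lookup p b))) / to_fract ?V)"
    unfolding \<theta>_apply
  proof (rule sum.cong)
    fix b assume b: "b \<in> keys p"
    have "basis_form (g b) ?v = to_fract (subst (shift ?v) (single (top_exponent (g b)) 1)) / to_fract ?V"
      by (rule basis_form_top[OF g(1)[OF b] g(2)[OF b, symmetric]])
    then have "const (- lookup p b) * basis_form (g b) ?v
        = to_fract (subst (shift ?v) (single 0 (- lookup p b) * single b 1)) / to_fract ?V"
      by (simp add: const_def g(3)[OF b])
    then show "const (- lookup p b) * basis_form (g b) ?v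
        = to_fract (subst (shift ?v) (single b (- lookup p b))) / to_fract ?V"
      by (simp add: mult_single del: subst_mult)
  qed simp
  also have "\<dots> = to_fract (subst (shift ?v) (\<Sum>b\<in>keys p. single b (- lookup p b))) / to_fract ?V"
    by (simp only: subst_sum to_fract_sum sum_divide_distrib)
  also have "(\<Sum>b\<in>keys p. single b (- lookup p b)) = - p"
    by (simp only: single_uminus sum_negf poly_eq_sum_single[symmetric])
  finally have \<theta>v: "\<omega> ?v + \<theta> ?v = 0" by (simp add: \<omega>v)
  have "\<omega> + \<theta> \<in> graded_part log_module d"
    unfolding \<theta>_def using Suc.prems(2) g(1) by (intro graded_part_add_sum basis_form_graded)
  moreover have "(\<omega> + \<theta>) i = 0" if i: "i > w" for i
  proof (cases "i = ?v")
    case False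
    then have "i > ?v" using i by simp
    then have "basis_form (g b) i = (0 :: 'k ratfun)" if "b \<in> keys p" for b
      using g(1,2)[OF that] by (intro basis_form_above) auto
    then have "\<theta> i = 0" unfolding \<theta>_apply by simp
    then show ?thesis using Suc.prems(3)[OF \<open>i > ?v\<close>] by simp
  qed (use \<theta>v in simp)
  ultimately have "\<omega> + \<theta> \<in> form.span (basis_form ` basis_index d)"
    by (rule Suc.IH[OF Suc_leD[OF Suc.prems(1)]])
  moreover have "\<theta> \<in> form.span (basis_form ` basis_index d)"
    unfolding \<theta>_def using g(1) by (intro form.span_sum form.span_scale form.span_base) auto
  ultimately have "(\<omega> + \<theta>) - \<theta> \<in> form.span (basis_form ` basis_index d)"
    by (rule form.span_diff)
  then show ?case by (simp only: add_diff_cancel_right')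
qed

lemma basis_form_span:
  "graded_part (log_module :: ('k::field) form1 set) d \<subseteq> form.span (basis_form ` basis_index d)"
proof
  fix \<omega> :: "'k form1" assume \<omega>: "\<omega> \<in> graded_part log_module d"
  moreover have "\<omega> i = 0" if "i > l" for i
    using \<omega> that by (auto simp: graded_part_def log_module_def log_numerators_def)
  ultimately show "\<omega> \<in> form.span (basis_form ` basis_index d)"
    using basis_form_span_aux[of l \<omega> d] by blast
qed

section \<open>Dimensions and the Hilbert series\<close>

lemma dim_graded_part:
  "form.dim (graded_part (log_module :: ('k::field) form1 set) d) = card (basis_index d)"
proof -
  note ind = form_independent_family[of "basis_index d" "basis_form :: _ \<Rightarrow> 'k form1",
      OF finite_basis_index basis_form_independent]
  show ?thesis
  proof (rule form.dim_unique)
    show "basis_form ` basis_index d \<subseteq> graded_part (log_module :: 'k form1 set) d"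
      using basis_form_graded by blast
    show "card (basis_form ` basis_index d :: 'k form1 set) = card (basis_index d)"
      by (rule card_image[OF ind(1)])
  qed (use ind(2) basis_form_span in auto)
qed

lemma Hilb_defined_log_module: "Hilb_defined (log_module :: ('k::field) form1 set)"
  unfolding Hilb_defined_def
proof (intro conjI allI)
  fix d
  show "\<exists>B. finite B \<and> graded_part log_module d \<subseteq> form.span (B :: 'k form1 set)"
    by (intro exI[of _ "basis_form ` basis_index d"] conjI finite_imageI finite_basis_index basis_form_span)
next
  \<comment> \<open>As \<open>card F \<le> l\<close>, the monomial would need a negative degree for
    such \<open>n\<close>.\<close>
  have "graded_part log_module (- int n) \<subseteq> {0 :: 'k form1}" if n: "n > l" for n
  proof -
    have "{b. keys b \<subseteq> A \<and> int (monomial_degree b) = - int n + int (card F) - 1} = {}"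
      if "F \<in> clique_complex l E - {{}}" for F A
      using card_mono[OF _ clique_complexD(3)[OF that]] n by auto
    then have "basis_index (- int n) = {}"
      unfolding basis_index_def by (auto simp only: Sigma_empty2 cong: Sigma_cong)
    then show ?thesis using basis_form_span[of "- int n", where 'k='k] by simp
  qed
  then show "\<forall>\<^sub>\<infinity>n. graded_part log_module (- int n) \<subseteq> {0 :: 'k form1}"
    unfolding MOST_nat by blast
qed

lemma Hilb_log_module:
  "Hilb (log_module :: ('k::field) form1 set) = (\<Sum>F\<in>clique_complex l E - {{}}.
     fls_X powi (1 - int (card F)) / (1 - fls_X) ^ (l - card F + 1))"
  (is "_ = ?R")
proof -
  have "fls_nth ?R d = of_nat (form.dim (graded_part (log_module :: 'k form1 set) d))" for d
  proof -
    have fibre: "fls_nth (fls_X powi (1 - int (card F)) / (1 - fls_X) ^ (l - card F + 1) :: rat fls) d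
      = of_nat (card {b. keys b \<subseteq> {1..l} - (F - {Max F}) \<and> int (monomial_degree b) = d + int (card F) - 1})"
      if F: "F \<in> clique_complex l E - {{}}" for F
    proof -
      note F' = clique_complexD[OF F]
      let ?A = "{1..l} - (F - {Max F})"
      have "card (F - {Max F}) = card F - 1" using F'(1,2) by simp
      moreover have "card F \<le> l" using card_mono[OF _ F'(3)] by simp
      moreover have "card F \<noteq> 0" using F F'(1) by auto
      moreover have "card ?A = l - card (F - {Max F})"
        using F'(1,3) by (subst card_Diff_subset) auto
      \<comment> \<open>\<open>card F \<le> l\<close> and \<open>card F \<noteq> 0\<close> keep the
        natural subtractions from truncating.\<close>
      ultimately have "l - card F + 1 = card ?A" by simp
      then have "fls_nth (fls_X powi (1 - int (card F)) / (1 - fls_X) ^ (l - card F + 1) :: rat fls) d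
        = (if d < 1 - int (card F) then 0 else of_nat (card (exponents ?A (nat (d - (1 - int (card F)))))))"
        using fls_nth_exponents[of ?A "1 - int (card F)" d] by (simp only: finite_Diff finite_atLeastAtMost)
      also have "\<dots> = of_nat (card (if d + int (card F) - 1 < 0 then {} else exponents ?A (nat (d + int (card F) - 1))))"
        by (simp add: algebra_simps)
      finally show ?thesis by (simp only: basis_index_fibre)
    qed
    have "fls_nth ?R d = of_nat (\<Sum>F\<in>clique_complex l E - {{}}.
        card {b. keys b \<subseteq> {1..l} - (F - {Max F}) \<and> int (monomial_degree b) = d + int (card F) - 1})"
      unfolding fls_nth_sum of_nat_sum by (rule sum.cong[OF refl fibre])
    also have "\<dots> = of_nat (card (basis_index d))"
      unfolding basis_index_def
      by (subst card_SigmaI) (simp_all add: finite_clique_complex basis_index_fibre)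
    finally show ?thesis unfolding dim_graded_part .
  qed
  \<comment> \<open>\<open>Abs_fls\<close> is inverse to \<open>fls_nth\<close> only on sequences
    vanishing in low degrees; equality with the coefficients of \<open>?R\<close> supplies
    this.\<close>
  then have "(\<lambda>d. of_nat (form.dim (graded_part (log_module :: 'k form1 set) d))) = fls_nth ?R"
    by (intro ext) (rule sym)
  then have "Hilb (log_module :: 'k form1 set) = Abs_fls (fls_nth ?R)"
    unfolding Hilb_def by (rule arg_cong)
  then show ?thesis by (simp only: fls_nth_inverse)
qed

end

theorem theorem7p11:
  fixes l :: nat
    and E :: "nat set set"
    and \<alpha> :: "(nat \<Rightarrow> 'k::field) set \<Rightarrow> nat \<Rightarrow> 'k"
  assumes "E \<subseteq> [{1..l}]\<^bsup>2\<^esup>"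
    and "\<And>H. H \<in> graphic_arrangement l E \<Longrightarrow> is_defining_form l (\<alpha> H) H"
  shows "Hilb_defined (log_forms l \<alpha> (graphic_arrangement l E))
    \<and> Hilb (log_forms l \<alpha> (graphic_arrangement l E)) =
        (\<Sum>F\<in>clique_complex l E - {{}}.
           fls_X powi (1 - int (card F)) / (1 - fls_X) ^ (l - card F + 1))"
proof -
  interpret simple_graph l E by standard (rule assms(1))
  have "log_forms l \<alpha> (graphic_arrangement l E) = log_module"
    unfolding log_module_def by (rule log_forms_eq[OF assms(2)])
  then show ?thesis
    by (simp only: Hilb_defined_log_module Hilb_log_module conj_absorb simp_thms)
qed

end
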